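(* Let $M$ be a smooth manifold, $h$ a non-degenerate $(0,2)$-tensor field on $M$ which is either symmetric or skew-symmetric, and $\nabla$ an affine connection on $M$. Let $\hat h$ be the bilinear form on $TM\oplus T^*M$ given by $$\hat h(X+\alpha,Y+\beta)=-\tfrac12(\alpha(Y)+\beta(X))\ \text{ if } h \text{ is symmetric},\qquad \hat h(X+\alpha,Y+\beta)=-\tfrac12(\alpha(Y)-\beta(X))\ \text{ if } h \text{ is skew-symmetric},$$ and let $\hat\nabla$ be the affine connection on $TM\oplus T^*M$ given by $\hat\nabla_{X+\alpha}(Y+\beta)=\nabla_XY+h(\nabla_X(h^{-1}(\beta)))$. Then $(TM\oplus T^*M,\hat h,\hat\nabla)$ is a generalized quasi-statistical manifold (that is, $d^{\hat\nabla}\hat h=0$, with the torsion of $\hat\nabla$ defined through the bracket $[\cdot,\cdot]_\nabla$) if and only if $(M,h,\nabla)$ is a quasi-statistical manifold.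
   Context: $C^\infty(E)$ denotes smooth sections of $E$. An affine connection $\nabla$ on $M$ may have torsion $T^\nabla(X,Y)=\nabla_XY-\nabla_YX-[X,Y]$; $(\nabla_X\beta)(Y)=X(\beta(Y))-\beta(\nabla_XY)$ for 1-forms $\beta$. $h$ also denotes the isomorphism $TM\to T^*M$, $h(X)=h(X,\cdot)$, with inverse $h^{-1}$. $(M,h,\nabla)$ is a quasi-statistical manifold if $d^\nabla h=0$, where $(d^\nabla h)(X,Y,Z)=(\nabla_Xh)(Y,Z)-(\nabla_Yh)(X,Z)+h(T^\nabla(X,Y),Z)$. An affine connection $D$ on $TM\oplus T^*M$ is an $\mathbb R$-bilinear map $(\sigma,\tau)\mapsto D_\sigma\tau$ on $C^\infty(TM\oplus T^*M)$ with $D_{f\sigma}\tau=fD_\sigma\tau$ and $D_\sigma(f\tau)=\sigma(f)\tau+fD_\sigma\tau$, where $(X+\alpha)(f)=X(f)$. Its torsion is $T^D(\sigma,\tau)=D_\sigma\tau-D_\tau\sigma-[\sigma,\tau]_\nabla$, where $[X+\alpha,Y+\beta]_\nabla=[X,Y]+\nabla_X\beta-\nabla_Y\alpha$. For a non-degenerate bilinear form $k$ on $TM\oplus T^*M$, $(k,D)$ is a generalized quasi-statistical structure if $d^Dk=0$, where $(d^Dk)(\sigma,\tau,\nu)=(D_\sigma k)(\tau,\nu)-(D_\tau k)(\sigma,\nu)+k(T^D(\sigma,\tau),\nu)$ and $(D_\sigma k)(\tau,\nu)=\sigma(k(\tau,\nu))-k(D_\sigma\tau,\nu)-k(\tau,D_\sigma\nu)$.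 *)

theory Defs
  imports "HOL-Analysis.Analysis" "HOL-Library.Function_Algebras"
begin

text \<open>
  Tangent vectors and covectors are real-valued functions, with pointwise vector space operations.
\<close>

instantiation "fun" :: (type, scaleR) scaleR
begin
definition "scaleR c f = (\<lambda>x. c *\<^sub>R f x)"
instance ..
end

instance "fun" :: (type, real_vector) real_vector
  by standard (simp_all add: scaleR_fun_def fun_eq_iff scaleR_add_right scaleR_add_left)

section \<open>Smooth manifolds\<close>

text \<open>
  The sets \<open>V\<close> below are open, so that \<open>at x within V\<close> is \<open>at x\<close>, or else contained in \<open>{0}\<close>
  (charts of a manifold of dimension zero), in which case every function is smooth on \<open>V\<close>.
\<close>

primrec Ck_on :: "nat \<Rightarrow> 'e::euclidean_space set \<Rightarrow> ('e \<Rightarrow> 'b::real_normed_vector) \<Rightarrow> bool" where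
  "Ck_on 0 V g \<longleftrightarrow> continuous_on V g"
| "Ck_on (Suc k) V g \<longleftrightarrow>
     (\<forall>x\<in>V. g differentiable (at x within V)) \<and>
     (\<forall>b\<in>Basis. Ck_on k V (\<lambda>x. frechet_derivative g (at x within V) b))"

definition smooth_on :: "'e::euclidean_space set \<Rightarrow> ('e \<Rightarrow> 'b::real_normed_vector) \<Rightarrow> bool" where
  "smooth_on V g \<longleftrightarrow> (\<forall>k. Ck_on k V g)"

type_synonym ('a, 'e) atlas = "('a set \<times> ('a \<Rightarrow> 'e)) set"

text \<open>
  The manifold is the whole type \<open>'a\<close>; it is Hausdorff and second countable by its sort wherever
  \<open>smooth_atlas\<close> is used. The charts map onto open subsets of \<open>'e\<close>; since \<open>DIM('e) > 0\<close>, manifolds of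
  dimension zero are covered by the second alternative, in which the model space is \<open>{0}\<close>.
\<close>

definition smooth_atlas ::
    "('a::{t2_space,second_countable_topology}, 'e::euclidean_space) atlas \<Rightarrow> bool" where
  "smooth_atlas A \<longleftrightarrow>
     (\<Union>(U, \<phi>)\<in>A. U) = UNIV \<and>
     (\<forall>(U, \<phi>)\<in>A. open U \<and> (\<exists>\<psi>. homeomorphism U (\<phi> ` U) \<phi> \<psi>)) \<and>
     ((\<forall>(U, \<phi>)\<in>A. open (\<phi> ` U)) \<or> (\<forall>(U, \<phi>)\<in>A. \<phi> ` U \<subseteq> {0})) \<and>
     (\<forall>(U, \<phi>)\<in>A. \<forall>(U', \<phi>')\<in>A. smooth_on (\<phi> ` (U \<inter> U')) (\<phi>' \<circ> inv_into U \<phi>))"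

definition smooth_functions ::
    "('a, 'e::euclidean_space) atlas \<Rightarrow> ('a \<Rightarrow> real) set" where
  "smooth_functions A = {f. \<forall>(U, \<phi>)\<in>A. smooth_on (\<phi> ` U) (f \<circ> inv_into U \<phi>)}"

section \<open>Tangent and cotangent bundle\<close>

type_synonym 'a tvec = "('a \<Rightarrow> real) \<Rightarrow> real"
type_synonym 'a covec = "'a tvec \<Rightarrow> real"

text \<open>
  Tangent vectors at \<open>p\<close> are the derivations at \<open>p\<close> of the algebra of smooth functions. Tangent vectors
  and covectors vanish outside their domain, so that equality of functions is the intended equality.
\<close>

definition tangent_space :: "('a, 'e::euclidean_space) atlas \<Rightarrow> 'a \<Rightarrow> 'a tvec set" where
  "tangent_space A p = {v.
     (\<forall>f\<in>smooth_functions A. \<forall>g\<in>smooth_functions A. v (f + g) = v f + v g) \<and>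
     (\<forall>c. \<forall>f\<in>smooth_functions A. v (c *\<^sub>R f) = c * v f) \<and>
     (\<forall>f\<in>smooth_functions A. \<forall>g\<in>smooth_functions A. v (f * g) = v f * g p + f p * v g) \<and>
     (\<forall>f. f \<notin> smooth_functions A \<longrightarrow> v f = 0)}"

definition cotangent_space :: "('a, 'e::euclidean_space) atlas \<Rightarrow> 'a \<Rightarrow> 'a covec set" where
  "cotangent_space A p = {\<alpha>.
     (\<forall>v\<in>tangent_space A p. \<forall>w\<in>tangent_space A p. \<alpha> (v + w) = \<alpha> v + \<alpha> w) \<and>
     (\<forall>c. \<forall>v\<in>tangent_space A p. \<alpha> (c *\<^sub>R v) = c * \<alpha> v) \<and>
     (\<forall>v. v \<notin> tangent_space A p \<longrightarrow> \<alpha> v = 0)}"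

definition vector_fields :: "('a, 'e::euclidean_space) atlas \<Rightarrow> ('a \<Rightarrow> 'a tvec) set" where
  "vector_fields A = {X. (\<forall>p. X p \<in> tangent_space A p) \<and>
     (\<forall>f\<in>smooth_functions A. (\<lambda>p. X p f) \<in> smooth_functions A)}"

definition one_forms :: "('a, 'e::euclidean_space) atlas \<Rightarrow> ('a \<Rightarrow> 'a covec) set" where
  "one_forms A = {\<alpha>. (\<forall>p. \<alpha> p \<in> cotangent_space A p) \<and>
     (\<forall>X\<in>vector_fields A. (\<lambda>p. \<alpha> p (X p)) \<in> smooth_functions A)}"

definition lie_bracket :: "('a \<Rightarrow> 'a tvec) \<Rightarrow> ('a \<Rightarrow> 'a tvec) \<Rightarrow> 'a \<Rightarrow> 'a tvec" where
  "lie_bracket X Y = (\<lambda>p f. X p (\<lambda>q. Y q f) - Y p (\<lambda>q. X q f))"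

text \<open>
  \<open>gen_space\<close> and \<open>gen_sections\<close> are the fibres and the smooth sections of \<open>TM \<oplus> T*M\<close>.
\<close>

definition gen_space :: "('a, 'e::euclidean_space) atlas \<Rightarrow> 'a \<Rightarrow> ('a tvec \<times> 'a covec) set" where
  "gen_space A p = tangent_space A p \<times> cotangent_space A p"

definition gen_sections ::
    "('a, 'e::euclidean_space) atlas \<Rightarrow> ('a \<Rightarrow> 'a tvec \<times> 'a covec) set" where
  "gen_sections A = {\<sigma>. fst \<circ> \<sigma> \<in> vector_fields A \<and> snd \<circ> \<sigma> \<in> one_forms A}"

section \<open>Quasi-statistical structures\<close>

text \<open>
  The notions for \<open>TM\<close> and for \<open>TM \<oplus> T*M\<close> are instances of the following ones for a bundle with
  fibres \<open>F p\<close>, smooth sections \<open>S\<close>, an anchor \<open>\<rho>\<close> into \<open>TM\<close>, through which a section acts on functions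
  by \<open>\<sigma>(f) = \<rho>(\<sigma>)(f)\<close>, and a bracket \<open>br\<close> on sections.
\<close>

definition smul :: "('a \<Rightarrow> real) \<Rightarrow> ('a \<Rightarrow> 'b) \<Rightarrow> 'a \<Rightarrow> 'b::real_vector" where
  "smul f \<sigma> = (\<lambda>p. f p *\<^sub>R \<sigma> p)"

definition act :: "('b \<Rightarrow> 'a tvec) \<Rightarrow> ('a \<Rightarrow> 'b) \<Rightarrow> ('a \<Rightarrow> real) \<Rightarrow> 'a \<Rightarrow> real" where
  "act \<rho> \<sigma> f = (\<lambda>p. \<rho> (\<sigma> p) f)"

definition app :: "('a \<Rightarrow> 'b \<Rightarrow> 'b \<Rightarrow> real) \<Rightarrow> ('a \<Rightarrow> 'b) \<Rightarrow> ('a \<Rightarrow> 'b) \<Rightarrow> 'a \<Rightarrow> real" where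
  "app k \<sigma> \<tau> = (\<lambda>p. k p (\<sigma> p) (\<tau> p))"

definition bilinear_form :: "('a, 'e::euclidean_space) atlas \<Rightarrow> ('a \<Rightarrow> 'b::real_vector set) \<Rightarrow> ('a \<Rightarrow> 'b) set \<Rightarrow>
    ('a \<Rightarrow> 'b \<Rightarrow> 'b \<Rightarrow> real) \<Rightarrow> bool" where
  "bilinear_form A F S k \<longleftrightarrow>
     (\<forall>p. \<forall>u\<in>F p. \<forall>v\<in>F p. \<forall>w\<in>F p. \<forall>c.
        k p (u + v) w = k p u w + k p v w \<and> k p w (u + v) = k p w u + k p w v \<and>
        k p (c *\<^sub>R u) w = c * k p u w \<and> k p w (c *\<^sub>R u) = c * k p w u) \<and>
     (\<forall>\<sigma>\<in>S. \<forall>\<tau>\<in>S. app k \<sigma> \<tau> \<in> smooth_functions A)"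

definition nondegenerate :: "('a \<Rightarrow> 'b::real_vector set) \<Rightarrow> ('a \<Rightarrow> 'b \<Rightarrow> 'b \<Rightarrow> real) \<Rightarrow> bool" where
  "nondegenerate F k \<longleftrightarrow> (\<forall>p. \<forall>u\<in>F p. (\<forall>v\<in>F p. k p u v = 0) \<longrightarrow> u = 0)"

definition symmetric_form :: "('a \<Rightarrow> 'b set) \<Rightarrow> ('a \<Rightarrow> 'b \<Rightarrow> 'b \<Rightarrow> real) \<Rightarrow> bool" where
  "symmetric_form F k \<longleftrightarrow> (\<forall>p. \<forall>u\<in>F p. \<forall>v\<in>F p. k p u v = k p v u)"

definition skew_form :: "('a \<Rightarrow> 'b set) \<Rightarrow> ('a \<Rightarrow> 'b \<Rightarrow> 'b \<Rightarrow> real) \<Rightarrow> bool" where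
  "skew_form F k \<longleftrightarrow> (\<forall>p. \<forall>u\<in>F p. \<forall>v\<in>F p. k p u v = - k p v u)"

definition affine_connection :: "('a, 'e::euclidean_space) atlas \<Rightarrow> ('a \<Rightarrow> 'b::real_vector) set \<Rightarrow>
    ('b \<Rightarrow> 'a tvec) \<Rightarrow> (('a \<Rightarrow> 'b) \<Rightarrow> ('a \<Rightarrow> 'b) \<Rightarrow> 'a \<Rightarrow> 'b) \<Rightarrow> bool"
    where
  "affine_connection A S \<rho> D \<longleftrightarrow>
     (\<forall>\<sigma>\<in>S. \<forall>\<tau>\<in>S. D \<sigma> \<tau> \<in> S) \<and>
     (\<forall>\<sigma>\<in>S. \<forall>\<sigma>'\<in>S. \<forall>\<tau>\<in>S. D (\<sigma> + \<sigma>') \<tau> = D \<sigma> \<tau> + D \<sigma>' \<tau> \<and> D \<tau> (\<sigma> + \<sigma>') = D \<tau> \<sigma> + D \<tau> \<sigma>') \<and>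
     (\<forall>c. \<forall>\<sigma>\<in>S. \<forall>\<tau>\<in>S. D (c *\<^sub>R \<sigma>) \<tau> = c *\<^sub>R D \<sigma> \<tau> \<and> D \<sigma> (c *\<^sub>R \<tau>) = c *\<^sub>R D \<sigma> \<tau>) \<and>
     (\<forall>f\<in>smooth_functions A. \<forall>\<sigma>\<in>S. \<forall>\<tau>\<in>S.
        D (smul f \<sigma>) \<tau> = smul f (D \<sigma> \<tau>) \<and>
        D \<sigma> (smul f \<tau>) = smul (act \<rho> \<sigma> f) \<tau> + smul f (D \<sigma> \<tau>))"

definition torsion :: "(('a \<Rightarrow> 'b) \<Rightarrow> ('a \<Rightarrow> 'b) \<Rightarrow> 'a \<Rightarrow> 'b) \<Rightarrow>
    (('a \<Rightarrow> 'b) \<Rightarrow> ('a \<Rightarrow> 'b) \<Rightarrow> 'a \<Rightarrow> 'b) \<Rightarrow> ('a \<Rightarrow> 'b) \<Rightarrow> ('a \<Rightarrow> 'b) \<Rightarrow> 'a \<Rightarrow> 'b::real_vector" where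
  "torsion br D \<sigma> \<tau> = D \<sigma> \<tau> - D \<tau> \<sigma> - br \<sigma> \<tau>"

definition cov_deriv :: "('b \<Rightarrow> 'a tvec) \<Rightarrow> (('a \<Rightarrow> 'b) \<Rightarrow> ('a \<Rightarrow> 'b) \<Rightarrow> 'a \<Rightarrow> 'b) \<Rightarrow>
    ('a \<Rightarrow> 'b \<Rightarrow> 'b \<Rightarrow> real) \<Rightarrow> ('a \<Rightarrow> 'b) \<Rightarrow> ('a \<Rightarrow> 'b) \<Rightarrow> ('a \<Rightarrow> 'b) \<Rightarrow> 'a \<Rightarrow> real" where
  "cov_deriv \<rho> D k \<sigma> \<tau> \<nu> = act \<rho> \<sigma> (app k \<tau> \<nu>) - app k (D \<sigma> \<tau>) \<nu> - app k \<tau> (D \<sigma> \<nu>)"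

definition ext_cov_deriv :: "('b::real_vector \<Rightarrow> 'a tvec) \<Rightarrow> (('a \<Rightarrow> 'b) \<Rightarrow> ('a \<Rightarrow> 'b) \<Rightarrow> 'a \<Rightarrow> 'b) \<Rightarrow>
    (('a \<Rightarrow> 'b) \<Rightarrow> ('a \<Rightarrow> 'b) \<Rightarrow> 'a \<Rightarrow> 'b) \<Rightarrow> ('a \<Rightarrow> 'b \<Rightarrow> 'b \<Rightarrow> real) \<Rightarrow>
    ('a \<Rightarrow> 'b) \<Rightarrow> ('a \<Rightarrow> 'b) \<Rightarrow> ('a \<Rightarrow> 'b) \<Rightarrow> 'a \<Rightarrow> real" where
  "ext_cov_deriv \<rho> br D k \<sigma> \<tau> \<nu> =
     cov_deriv \<rho> D k \<sigma> \<tau> \<nu> - cov_deriv \<rho> D k \<tau> \<sigma> \<nu> + app k (torsion br D \<sigma> \<tau>) \<nu>"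

definition quasi_stat_structure :: "('a, 'e::euclidean_space) atlas \<Rightarrow> ('a \<Rightarrow> 'b::real_vector set) \<Rightarrow>
    ('a \<Rightarrow> 'b) set \<Rightarrow> ('b \<Rightarrow> 'a tvec) \<Rightarrow> (('a \<Rightarrow> 'b) \<Rightarrow> ('a \<Rightarrow> 'b) \<Rightarrow> 'a \<Rightarrow> 'b) \<Rightarrow>
    ('a \<Rightarrow> 'b \<Rightarrow> 'b \<Rightarrow> real) \<Rightarrow> (('a \<Rightarrow> 'b) \<Rightarrow> ('a \<Rightarrow> 'b) \<Rightarrow> 'a \<Rightarrow> 'b) \<Rightarrow> bool"
    where
  "quasi_stat_structure A F S \<rho> br k D \<longleftrightarrow>
     bilinear_form A F S k \<and> nondegenerate F k \<and> affine_connection A S \<rho> D \<and>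
     (\<forall>\<sigma>\<in>S. \<forall>\<tau>\<in>S. \<forall>\<nu>\<in>S. ext_cov_deriv \<rho> br D k \<sigma> \<tau> \<nu> = 0)"

definition quasi_statistical :: "('a, 'e::euclidean_space) atlas \<Rightarrow>
    ('a \<Rightarrow> 'a tvec \<Rightarrow> 'a tvec \<Rightarrow> real) \<Rightarrow>
    (('a \<Rightarrow> 'a tvec) \<Rightarrow> ('a \<Rightarrow> 'a tvec) \<Rightarrow> 'a \<Rightarrow> 'a tvec) \<Rightarrow> bool" where
  "quasi_statistical A h D \<longleftrightarrow>
     quasi_stat_structure A (tangent_space A) (vector_fields A) id lie_bracket h D"

text \<open>
  The covariant derivative \<open>\<nabla>\<^sub>X \<beta>\<close> is the 1-form determined by
  \<open>(\<nabla>\<^sub>X \<beta>)(Y) = X(\<beta>(Y)) - \<beta>(\<nabla>\<^sub>X Y)\<close>; the right-hand side is linear over smooth functions in \<open>Y\<close>.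
\<close>

definition cov_form :: "('a, 'e::euclidean_space) atlas \<Rightarrow>
    (('a \<Rightarrow> 'a tvec) \<Rightarrow> ('a \<Rightarrow> 'a tvec) \<Rightarrow> 'a \<Rightarrow> 'a tvec) \<Rightarrow>
    ('a \<Rightarrow> 'a tvec) \<Rightarrow> ('a \<Rightarrow> 'a covec) \<Rightarrow> 'a \<Rightarrow> 'a covec" where
  "cov_form A D X \<beta> = (THE \<gamma>. \<gamma> \<in> one_forms A \<and>
     (\<forall>Y\<in>vector_fields A. \<forall>p. \<gamma> p (Y p) = X p (\<lambda>q. \<beta> q (Y q)) - \<beta> p (D X Y p)))"

definition gen_bracket :: "('a, 'e::euclidean_space) atlas \<Rightarrow>
    (('a \<Rightarrow> 'a tvec) \<Rightarrow> ('a \<Rightarrow> 'a tvec) \<Rightarrow> 'a \<Rightarrow> 'a tvec) \<Rightarrow>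
    ('a \<Rightarrow> 'a tvec \<times> 'a covec) \<Rightarrow> ('a \<Rightarrow> 'a tvec \<times> 'a covec) \<Rightarrow> 'a \<Rightarrow> 'a tvec \<times> 'a covec" where
  "gen_bracket A D \<sigma> \<tau> = (\<lambda>p.
     (lie_bracket (fst \<circ> \<sigma>) (fst \<circ> \<tau>) p,
      cov_form A D (fst \<circ> \<sigma>) (snd \<circ> \<tau>) p - cov_form A D (fst \<circ> \<tau>) (snd \<circ> \<sigma>) p))"

definition gen_quasi_statistical :: "('a, 'e::euclidean_space) atlas \<Rightarrow>
    (('a \<Rightarrow> 'a tvec) \<Rightarrow> ('a \<Rightarrow> 'a tvec) \<Rightarrow> 'a \<Rightarrow> 'a tvec) \<Rightarrow>
    ('a \<Rightarrow> 'a tvec \<times> 'a covec \<Rightarrow> 'a tvec \<times> 'a covec \<Rightarrow> real) \<Rightarrow>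
    (('a \<Rightarrow> 'a tvec \<times> 'a covec) \<Rightarrow> ('a \<Rightarrow> 'a tvec \<times> 'a covec) \<Rightarrow> 'a \<Rightarrow> 'a tvec \<times> 'a covec) \<Rightarrow>
    bool" where
  "gen_quasi_statistical A nabla k D \<longleftrightarrow>
     quasi_stat_structure A (gen_space A) (gen_sections A) fst (gen_bracket A nabla) k D"

section \<open>The induced form and connection on the generalized tangent bundle\<close>

definition flat :: "('a, 'e::euclidean_space) atlas \<Rightarrow> ('a \<Rightarrow> 'a tvec \<Rightarrow> 'a tvec \<Rightarrow> real) \<Rightarrow>
    ('a \<Rightarrow> 'a tvec) \<Rightarrow> 'a \<Rightarrow> 'a covec" where
  "flat A h X = (\<lambda>p w. if w \<in> tangent_space A p then h p (X p) w else 0)"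

text \<open>
  \<open>flat\<close> is \<open>h : TM \<rightarrow> T*M\<close> and \<open>sharp\<close> is its inverse \<open>h\<^sup>-\<^sup>1\<close>, for non-degenerate \<open>h\<close>.
\<close>

definition sharp :: "('a, 'e::euclidean_space) atlas \<Rightarrow> ('a \<Rightarrow> 'a tvec \<Rightarrow> 'a tvec \<Rightarrow> real) \<Rightarrow>
    ('a \<Rightarrow> 'a covec) \<Rightarrow> 'a \<Rightarrow> 'a tvec" where
  "sharp A h \<beta> = (\<lambda>p. THE v. v \<in> tangent_space A p \<and> (\<forall>w\<in>tangent_space A p. h p v w = \<beta> p w))"

text \<open>
  \<open>hat_form\<close> is used for symmetric or skew-symmetric \<open>h\<close> only. If a non-degenerate \<open>h\<close> is both, then
  all fibres are trivial and the two formulas agree.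
\<close>

definition hat_form :: "('a, 'e::euclidean_space) atlas \<Rightarrow> ('a \<Rightarrow> 'a tvec \<Rightarrow> 'a tvec \<Rightarrow> real) \<Rightarrow>
    'a \<Rightarrow> 'a tvec \<times> 'a covec \<Rightarrow> 'a tvec \<times> 'a covec \<Rightarrow> real" where
  "hat_form A h = (\<lambda>p (u, \<alpha>) (w, \<beta>).
     if symmetric_form (tangent_space A) h then - (1 / 2) * (\<alpha> w + \<beta> u)
     else - (1 / 2) * (\<alpha> w - \<beta> u))"

definition hat_connection :: "('a, 'e::euclidean_space) atlas \<Rightarrow>
    ('a \<Rightarrow> 'a tvec \<Rightarrow> 'a tvec \<Rightarrow> real) \<Rightarrow>
    (('a \<Rightarrow> 'a tvec) \<Rightarrow> ('a \<Rightarrow> 'a tvec) \<Rightarrow> 'a \<Rightarrow> 'a tvec) \<Rightarrow>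
    ('a \<Rightarrow> 'a tvec \<times> 'a covec) \<Rightarrow> ('a \<Rightarrow> 'a tvec \<times> 'a covec) \<Rightarrow> 'a \<Rightarrow> 'a tvec \<times> 'a covec" where
  "hat_connection A h D \<sigma> \<tau> = (\<lambda>p.
     (D (fst \<circ> \<sigma>) (fst \<circ> \<tau>) p, flat A h (D (fst \<circ> \<sigma>) (sharp A h (snd \<circ> \<tau>))) p))"

end

theory Submission
  imports Defs
begin

text \<open>
  Write sections of \<open>TM \<oplus> T*M\<close> as \<open>X + h(A)\<close>, \<open>Y + h(B)\<close>, \<open>Z + h(C)\<close>. In the exterior covariant
  derivative of the hat form all terms with \<open>A\<close> or \<open>B\<close> cancel, because the cotangent part of
  \<open>[X + h(A), Y + h(B)]\<^sub>\<nabla>\<close> is \<open>h(\<nabla>\<^sub>X B) - h(\<nabla>\<^sub>Y A) + (\<nabla>\<^sub>X h)(B,\<cdot>) - (\<nabla>\<^sub>Y h)(A,\<cdot>)\<close>; what remains is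
  \<open>- (d\<^sup>\<nabla>h)(X,Y,C) / 2\<close>. As \<open>C\<close> runs through all vector fields, the two vanishing conditions agree.

  That the hat connection and the bracket are well defined rests on local frames for the derivations of
  the algebra of smooth functions, which come from bump functions and Hadamard's lemma:
  \<open>h\<^sup>-\<^sup>1\<close> maps 1-forms to smooth vector fields by Gaussian elimination over germs of smooth functions,
  and \<open>\<nabla>\<^sub>X \<beta>\<close> exists because a \<open>C\<^sup>\<infinity>\<close>-linear operation on vector fields is pointwise.
\<close>

section \<open>Calculus of smooth functions\<close>

text \<open>Tangent vectors act on globally defined smooth functions, and smoothness of a field is
  tested on such functions only. Data from a chart (coordinates, partial derivatives, reciprocals,
  Hadamard quotients) must therefore be cut off to global functions before a derivation can be
  applied to them. Charts onto {0} do not have open images, so the calculus on open sets fails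
  there; dimension zero is treated apart and gets an empty frame. \<open>sharp\<close> and
  \<open>cov_form\<close> are definite descriptions: each needs existence and uniqueness, and
  existence of h^-1(\<beta>) at every point says nothing yet about smoothness. The two symmetry
  types are merged by the sign \<open>form_sign\<close>, written e here: h(u,v) = e h(v,u), and the
  hat form is - (\<alpha>(w) + e \<beta>(u)) / 2, so that pairing a vector w with h(C) in second
  position always contributes h(w,C). Bilinearity, non-degeneracy and the connection axioms hold on
  both sides under the assumptions, so the equivalence concerns the two vanishing conditions
  alone.\<close>

lemma Ck_on_cong:
  assumes "\<And>x. x \<in> V \<Longrightarrow> f x = g x"
  shows "Ck_on k V f \<longleftrightarrow> Ck_on k V g"
  using assms
proof (induction k arbitrary: f g)
  case 0
  then show ?case by (simp cong: continuous_on_cong)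
next
  case (Suc k)
  have d: "(f has_derivative f') (at x within V) \<longleftrightarrow> (g has_derivative f') (at x within V)"
    if "x \<in> V" for x f'
    using that Suc.prems by (metis has_derivative_transform)
  \<comment> \<open>\<open>frechet_derivative\<close> is a choice made from the predicate of being a
    derivative. Equal predicates give equal choices, even where the derivative within V is not
    unique.\<close>
  have "frechet_derivative f (at x within V) = frechet_derivative g (at x within V)"
    if "x \<in> V" for x
    unfolding frechet_derivative_def using d[OF that] by simp
  moreover have "f differentiable (at x within V) \<longleftrightarrow> g differentiable (at x within V)" if "x \<in> V" for x
    unfolding differentiable_def using d[OF that] by simp
  moreover have "Ck_on k V (\<lambda>x. frechet_derivative f (at x within V) b) \<longleftrightarrow>
      Ck_on k V (\<lambda>x. frechet_derivative g (at x within V) b)" for b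
    by (rule Suc.IH) (simp add: calculation(1))
  ultimately show ?case by simp
qed

text \<open>On open sets derivatives are unique, so an explicit formula may replace
  \<open>frechet_derivative\<close>. The product, inverse and chain rules below are inductions
  through this rule.\<close>

lemma Ck_on_SucI:
  assumes "open V" "\<And>x. x \<in> V \<Longrightarrow> (g has_derivative g' x) (at x)"
    and "\<And>b. b \<in> Basis \<Longrightarrow> Ck_on k V (\<lambda>x. g' x b)"
  shows "Ck_on (Suc k) V g"
proof -
  have "frechet_derivative g (at x within V) = g' x" if "x \<in> V" for x
    using that assms(1,2) by (metis at_within_open frechet_derivative_at)
  then have "Ck_on k V (\<lambda>x. frechet_derivative g (at x within V) b) = Ck_on k V (\<lambda>x. g' x b)" for b
    by (intro Ck_on_cong) simp
  moreover have "g differentiable (at x within V)" if "x \<in> V" for x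
    using that assms(1,2) by (metis at_within_open differentiableI)
  ultimately show ?thesis
    unfolding Ck_on.simps using assms(3) by blast
qed

lemma Ck_on_SucD:
  assumes "open V" "Ck_on (Suc k) V g"
  shows "x \<in> V \<Longrightarrow> (g has_derivative frechet_derivative g (at x)) (at x)"
    and "b \<in> Basis \<Longrightarrow> Ck_on k V (\<lambda>x. frechet_derivative g (at x) b)"
proof -
  show "x \<in> V \<Longrightarrow> (g has_derivative frechet_derivative g (at x)) (at x)"
    using assms by (auto simp: at_within_open[OF _ assms(1)] frechet_derivative_works)
  assume "b \<in> Basis"
  then have "Ck_on k V (\<lambda>x. frechet_derivative g (at x within V) b)" using assms(2) by simp
  then show "Ck_on k V (\<lambda>x. frechet_derivative g (at x) b)"
    by (rule iffD1[OF Ck_on_cong, rotated]) (simp add: at_within_open[OF _ assms(1)])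
qed

lemma Ck_on_Suc_imp: "open V \<Longrightarrow> Ck_on (Suc k) V g \<Longrightarrow> Ck_on k V g"
proof (induction k arbitrary: g)
  case 0
  then show ?case
    by (auto simp: continuous_on_eq_continuous_within intro!: differentiable_imp_continuous_within)
next
  case (Suc k)
  show ?case
    by (rule Ck_on_SucI[OF Suc.prems(1)])
      (use Suc.IH Ck_on_SucD[OF Suc.prems] Suc.prems(1) in auto)
qed

lemma Ck_on_continuous: "open V \<Longrightarrow> Ck_on k V g \<Longrightarrow> continuous_on V g"
  by (induction k) (simp, blast intro: Ck_on_Suc_imp)

lemma Ck_on_local:
  assumes "open V" "\<And>x. x \<in> V \<Longrightarrow> \<exists>W. open W \<and> x \<in> W \<and> Ck_on k W g"
  shows "Ck_on k V g"
  using assms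
proof (induction k arbitrary: g)
  case 0
  have "isCont g x" if x: "x \<in> V" for x
    using 0(2)[OF x] by (auto simp: continuous_on_eq_continuous_at)
  then show ?case by (simp add: continuous_at_imp_continuous_on)
next
  case (Suc k)
  show ?case
  proof (rule Ck_on_SucI[OF Suc.prems(1)])
    fix x assume "x \<in> V"
    then obtain W where "open W" "x \<in> W" "Ck_on (Suc k) W g" using Suc.prems(2) by blast
    then show "(g has_derivative frechet_derivative g (at x)) (at x)" using Ck_on_SucD(1) by blast
  next
    fix b :: 'a assume b: "b \<in> Basis"
    show "Ck_on k V (\<lambda>x. frechet_derivative g (at x) b)"
    proof (rule Suc.IH[OF Suc.prems(1)])
      fix x assume "x \<in> V"
      then obtain W where "open W" "x \<in> W" "Ck_on (Suc k) W g" using Suc.prems(2) by blast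
      then show "\<exists>W. open W \<and> x \<in> W \<and> Ck_on k W (\<lambda>x. frechet_derivative g (at x) b)"
        using Ck_on_SucD(2)[OF _ _ b] by metis
    qed
  qed
qed

lemma Ck_on_subset: "open V \<Longrightarrow> Ck_on k V g \<Longrightarrow> open W \<Longrightarrow> W \<subseteq> V \<Longrightarrow> Ck_on k W g"
proof (induction k arbitrary: g)
  case 0
  then show ?case by (auto intro: continuous_on_subset)
next
  case (Suc k)
  show ?case
    by (rule Ck_on_SucI[OF Suc.prems(3)]) (use Suc.IH Ck_on_SucD[OF Suc.prems(1,2)] Suc.prems in auto)
qed

lemma Ck_on_const: "open V \<Longrightarrow> Ck_on k V (\<lambda>x. c)"
  by (induction k arbitrary: c)
    (simp, rule Ck_on_SucI[where g' = "\<lambda>x b. 0"], simp_all del: Ck_on.simps)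

lemma Ck_on_linear:
  assumes "bounded_linear L" "open V" "Ck_on k V g"
  shows "Ck_on k V (\<lambda>x. L (g x))"
  using assms(3)
proof (induction k arbitrary: g)
  case 0
  then show ?case by (simp add: bounded_linear.continuous_on[OF assms(1)])
next
  case (Suc k)
  show ?case
    by (rule Ck_on_SucI[OF assms(2) bounded_linear.has_derivative[OF assms(1)]])
      (use Suc.IH Ck_on_SucD[OF assms(2) Suc.prems] in auto)
qed

lemma Ck_on_add:
  assumes "open V" "Ck_on k V f" "Ck_on k V g"
  shows "Ck_on k V (\<lambda>x. f x + g x)"
  using assms(2,3)
proof (induction k arbitrary: f g)
  case 0
  then show ?case by (simp add: continuous_on_add)
next
  case (Suc k)
  show ?case
    by (rule Ck_on_SucI[OF assms(1) has_derivative_add])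
      (auto intro!: Suc.IH Ck_on_SucD[OF assms(1) Suc.prems(1)] Ck_on_SucD[OF assms(1) Suc.prems(2)] assms(1)
        simp del: Ck_on.simps)
qed

lemma Ck_on_sum:
  assumes "open V" "\<And>i. i \<in> I \<Longrightarrow> Ck_on k V (f i)"
  shows "Ck_on k V (\<lambda>x. \<Sum>i\<in>I. f i x)"
  using assms(2) by (induction I rule: infinite_finite_induct) (simp_all add: Ck_on_const Ck_on_add assms(1))

lemma Ck_on_mult:
  fixes f g :: "_ \<Rightarrow> real"
  assumes "open V" "Ck_on k V f" "Ck_on k V g"
  shows "Ck_on k V (\<lambda>x. f x * g x)"
  using assms(2,3)
proof (induction k arbitrary: f g)
  case 0
  then show ?case by (simp add: continuous_on_mult)
next
  case (Suc k)
  show ?case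
    by (rule Ck_on_SucI[OF assms(1) has_derivative_mult])
      (auto intro!: Ck_on_add Suc.IH Ck_on_SucD[OF assms(1) Suc.prems(1)] Ck_on_SucD[OF assms(1) Suc.prems(2)]
        Ck_on_Suc_imp[OF assms(1) Suc.prems(1)] Ck_on_Suc_imp[OF assms(1) Suc.prems(2)] assms(1)
        simp del: Ck_on.simps)
qed

text \<open>Here \<open>g\<close> stays fixed in the induction: the derivative of 1/g is a product
  of 1/g, g' and 1/g, so the induction hypothesis for the same \<open>g\<close> suffices.\<close>

lemma Ck_on_inverse:
  fixes g :: "_ \<Rightarrow> real"
  assumes "open V" "Ck_on k V g" "\<And>x. x \<in> V \<Longrightarrow> g x \<noteq> 0"
  shows "Ck_on k V (\<lambda>x. inverse (g x))"
  using assms(2)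
proof (induction k)
  case 0
  then show ?case using assms(3) by (simp add: continuous_on_inverse)
next
  case (Suc k)
  have "Ck_on k V (\<lambda>x. inverse (g x))" using Suc Ck_on_Suc_imp[OF assms(1)] by blast
  then have "Ck_on k V (\<lambda>x. - (inverse (g x) * frechet_derivative g (at x) b * inverse (g x)))"
    if "b \<in> Basis" for b
    by (intro Ck_on_linear[OF bounded_linear_minus[OF bounded_linear_ident]] Ck_on_mult assms(1)
        Ck_on_SucD(2)[OF assms(1) Suc.prems] that)
  then show ?case
    by (intro Ck_on_SucI[OF assms(1) Deriv.has_derivative_inverse])
      (use assms(3) Ck_on_SucD(1)[OF assms(1) Suc.prems] in auto)
qed

text \<open>Induction over \<open>f\<close> with \<open>g\<close> fixed. The derivative of
  \<open>f\<close> is expanded along \<open>Basis\<close>, which turns the chain rule into a sum of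
  products of real functions: components of g', and partial derivatives of \<open>f\<close> composed
  with \<open>g\<close>.\<close>

lemma Ck_on_compose:
  fixes f :: "'d::euclidean_space \<Rightarrow> real" and g :: "'e::euclidean_space \<Rightarrow> 'd"
  assumes "open V" "open W" "\<And>x. x \<in> V \<Longrightarrow> g x \<in> W" "Ck_on k V g" "Ck_on k W f"
  shows "Ck_on k V (\<lambda>x. f (g x))"
  using assms(4,5)
proof (induction k arbitrary: f)
  case 0
  then show ?case using assms(3) by (simp add: continuous_on_compose2 image_subset_iff)
next
  case (Suc k)
  let ?f' = "\<lambda>x. frechet_derivative f (at x)" and ?g' = "\<lambda>x. frechet_derivative g (at x)"
  note f' = Ck_on_SucD[OF assms(2) Suc.prems(2)] and g' = Ck_on_SucD[OF assms(1) Suc.prems(1)]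
  show ?case
  proof (rule Ck_on_SucI[OF assms(1)])
    show "((\<lambda>x. f (g x)) has_derivative (\<lambda>b. ?f' (g x) (?g' x b))) (at x)" if "x \<in> V" for x
      using has_derivative_compose[OF g'(1)[OF that] f'(1)] assms(3)[OF that] by blast
    have "Ck_on k V (\<lambda>x. \<Sum>c\<in>Basis. (?g' x b \<bullet> c) * ?f' (g x) c)" if "b \<in> Basis" for b
      by (intro Ck_on_sum Ck_on_mult assms(1) Suc.IH f'(2) g'(2) that
          Ck_on_linear[OF bounded_linear_inner_left] Ck_on_Suc_imp[OF assms(1) Suc.prems(1)])
    moreover have "?f' (g x) (?g' x b) = (\<Sum>c\<in>Basis. (?g' x b \<bullet> c) * ?f' (g x) c)" if "x \<in> V" for x b
    proof -
      interpret f': bounded_linear "?f' (g x)" using f'(1) assms(3) that has_derivative_bounded_linear by blast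
      have "?f' (g x) (?g' x b) = ?f' (g x) (\<Sum>c\<in>Basis. (?g' x b \<bullet> c) *\<^sub>R c)"
        by (simp add: euclidean_representation)
      then show ?thesis by (simp add: f'.sum f'.scaleR)
    qed
    ultimately show "Ck_on k V (\<lambda>x. ?f' (g x) (?g' x b))" if "b \<in> Basis" for b
      using that by (subst Ck_on_cong) auto
  qed
qed

lemma Ck_on_id: "open V \<Longrightarrow> Ck_on k V (\<lambda>x. x)"
  by (cases k) (simp, simp del: Ck_on.simps, rule Ck_on_SucI[where g' = "\<lambda>x b. b"],
      simp_all add: Ck_on_const del: Ck_on.simps)

lemma smooth_on_frechet:
  assumes "open V" "smooth_on V g" "b \<in> Basis"
  shows "smooth_on V (\<lambda>x. frechet_derivative g (at x) b)"
  using assms unfolding smooth_on_def by (blast intro: Ck_on_SucD(2))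

text \<open>At an isolated point of V every bounded linear map is a derivative within V, so
  differentiability there is no condition.\<close>

lemma Ck_on_trivial: "V \<subseteq> {0} \<Longrightarrow> Ck_on k V g"
proof (induction k arbitrary: g)
  case 0
  then have "V = {} \<or> V = {0}" by blast
  then show ?case by auto
next
  case (Suc k)
  have "V = {} \<or> V = {0}" using Suc by blast
  then have "f differentiable (at x within V)" if "x \<in> V" for x and f :: "'a \<Rightarrow> 'b"
    using that unfolding differentiable_def by (auto intro: has_derivative_within_singleton_iff[THEN iffD2] bounded_linear_zero)
  then show ?case using Suc by simp
qed

section \<open>Bump functions\<close>

text \<open>The classical flat function e^(-1/t), extended by 0, with a power of 1/t as extra
  factor. The derivative of each member is a combination of two others, so one induction generalised
  over \<open>m\<close> shows them all smooth.\<close>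

definition flat_exp :: "nat \<Rightarrow> real \<Rightarrow> real" where
  "flat_exp m t = (if t > 0 then exp (- inverse t) * inverse t ^ m else 0)"

lemma flat_exp_has_derivative:
  "(flat_exp m has_real_derivative flat_exp (m + 2) t - m * flat_exp (m + 1) t) (at t)"
proof (cases t "0 :: real" rule: linorder_cases)
  case less
  have "((\<lambda>t. 0) has_real_derivative 0) (at t)" by simp
  moreover have "\<forall>\<^sub>F s in nhds t. flat_exp m s = 0"
    using eventually_nhds_in_open[of "{..<0}" t] less by (auto simp: flat_exp_def elim: eventually_mono)
  ultimately show ?thesis
    using less by (subst DERIV_cong_ev[OF refl _ refl]) (auto simp: flat_exp_def)
next
  case greater
  have ev: "\<forall>\<^sub>F s in nhds t. flat_exp m s = exp (- inverse s) * inverse s ^ m"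
    using eventually_nhds_in_open[of "{0<..}" t] greater by (auto simp: flat_exp_def elim: eventually_mono)
  have "((\<lambda>s. exp (- inverse s) * inverse s ^ m) has_real_derivative
      flat_exp (m + 2) t - m * flat_exp (m + 1) t) (at t)"
    using greater power_eq_if[of t "m - 1"]
    by (cases m) (auto intro!: derivative_eq_intros simp: flat_exp_def power2_eq_square field_simps)
  then show ?thesis by (subst DERIV_cong_ev[OF refl ev refl])
next
  case equal
  \<comment> \<open>The difference quotient at 0 from the right is y^(m+1) / exp y with y = 1/s, and
    the exponential wins. From the left the quotient is identically 0.\<close>
  have "((\<lambda>s. inverse s ^ Suc m / exp (inverse s)) \<longlongrightarrow> 0) (at_right (0 :: real))"
    by (rule filterlim_compose[OF tendsto_power_div_exp_0 filterlim_inverse_at_top_right])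
  then have r: "((\<lambda>s. flat_exp m s / s) \<longlongrightarrow> 0) (at_right 0)"
    by (rule Lim_transform_eventually)
      (auto simp: flat_exp_def eventually_at_right_less eventually_at_filter exp_minus field_simps)
  have l: "((\<lambda>s. flat_exp m s / s) \<longlongrightarrow> 0) (at_left 0)"
    by (rule Lim_transform_eventually[OF tendsto_const])
      (auto simp: flat_exp_def eventually_at_filter)
  show ?thesis using r l equal
    by (simp add: has_field_derivative_iff filterlim_at_split flat_exp_def)
qed

lemma Ck_on_flat_exp: "Ck_on k UNIV (flat_exp m)"
proof (induction k arbitrary: m)
  case 0
  then show ?case
    by (auto intro: continuous_at_imp_continuous_on DERIV_isCont[OF flat_exp_has_derivative])
next
  case (Suc k)
  have "Ck_on k UNIV (\<lambda>t. flat_exp (m + 2) t + (- m) * flat_exp (m + 1) t)"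
    by (intro Ck_on_add Ck_on_mult Ck_on_const Suc open_UNIV)
  then show ?case
    by (intro Ck_on_SucI[OF open_UNIV flat_exp_has_derivative[unfolded has_field_derivative_def]]) simp
qed

text \<open>The standard quotient f(a) / (f(a) + f(b)) with f = \<open>flat_exp 0\<close>. Squared
  distances enter \<open>a\<close> and \<open>b\<close> because they are polynomial, hence smooth at
  the centre too.\<close>

lemma smooth_bump:
  fixes c :: "'e::euclidean_space"
  assumes "0 < r" "r < s"
  obtains u :: "'e \<Rightarrow> real" where "smooth_on UNIV u" "\<And>x. dist c x \<le> r \<Longrightarrow> u x = 1"
    "\<And>x. dist c x \<ge> s \<Longrightarrow> u x = 0"
proof -
  define a where "a x = (s\<^sup>2 - (x - c) \<bullet> (x - c))" for x
  define b where "b x = ((x - c) \<bullet> (x - c) - r\<^sup>2)" for x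
  let ?f = "flat_exp 0"
  have rs: "r\<^sup>2 < s\<^sup>2" using assms by (simp add: power_strict_mono)
  have d: "(x - c) \<bullet> (x - c) = (dist c x)\<^sup>2" for x
    by (simp add: dist_norm norm_minus_commute dot_square_norm)
  \<comment> \<open>In coordinates the squared norm is a sum of products of real functions, the
    shape that \<open>Ck_on_mult\<close> accepts.\<close>
  have "Ck_on k UNIV (\<lambda>x. \<Sum>i\<in>Basis. (x + - c) \<bullet> i * ((x + - c) \<bullet> i))" for k
    by (intro Ck_on_sum Ck_on_mult Ck_on_linear[OF bounded_linear_inner_left] Ck_on_add Ck_on_id
        Ck_on_const open_UNIV)
  then have q: "Ck_on k UNIV (\<lambda>x. (x - c) \<bullet> (x - c))" for k
    by (simp add: euclidean_inner[of "x - c" "x - c" for x])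
  have "Ck_on k UNIV (\<lambda>x. s\<^sup>2 + - ((x - c) \<bullet> (x - c)))" "Ck_on k UNIV (\<lambda>x. (x - c) \<bullet> (x - c) + - r\<^sup>2)" for k
    by (intro q Ck_on_add Ck_on_const Ck_on_linear[OF bounded_linear_minus[OF bounded_linear_ident]] open_UNIV)+
  then have "Ck_on k UNIV a" "Ck_on k UNIV b" for k
    by (simp_all add: a_def[abs_def] b_def[abs_def])
  then have fa: "Ck_on k UNIV (\<lambda>x. ?f (a x))" and fb: "Ck_on k UNIV (\<lambda>x. ?f (b x))" for k
    by (intro Ck_on_compose[OF open_UNIV open_UNIV UNIV_I _ Ck_on_flat_exp]; blast)+
  \<comment> \<open>a x + b x = s^2 - r^2 > 0, so at least one of the two arguments is
    positive.\<close>
  have pos: "?f (a x) + ?f (b x) > 0" for x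
    using rs unfolding a_def b_def flat_exp_def by (auto intro: add_pos_pos)
  show thesis
  proof
    show "smooth_on UNIV (\<lambda>x. ?f (a x) * inverse (?f (a x) + ?f (b x)))"
      unfolding smooth_on_def using pos[THEN less_imp_neq]
      by (intro allI Ck_on_mult Ck_on_inverse Ck_on_add fa fb open_UNIV) auto
    show "?f (a x) * inverse (?f (a x) + ?f (b x)) = 1" if "dist c x \<le> r" for x
    proof -
      have "(dist c x)\<^sup>2 \<le> r\<^sup>2" using that by (simp add: power_mono)
      then have "?f (b x) = 0" by (simp add: flat_exp_def b_def d)
      then show ?thesis using pos[of x] by simp
    qed
    show "?f (a x) * inverse (?f (a x) + ?f (b x)) = 0" if "dist c x \<ge> s" for x
    proof -
      have "s\<^sup>2 \<le> (dist c x)\<^sup>2" using that assms by (simp add: power_mono)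
      then show ?thesis by (simp add: flat_exp_def a_def d)
    qed
  qed
qed

section \<open>Hadamard's lemma\<close>

text \<open>Differentiating under the integral sign produces one more factor t by the chain rule.
  The weight t^m is there to absorb it, so the statement is stable under induction.\<close>

lemma Ck_on_segment_integral:
  fixes F :: "'e::euclidean_space \<Rightarrow> real"
  assumes "open B" "convex B" "c \<in> B" "Ck_on k B F"
  shows "Ck_on k B (\<lambda>x. integral {0..1} (\<lambda>t. t ^ m * F (c + t *\<^sub>R (x - c))))"
  using assms(4)
proof (induction k arbitrary: m F)
  case 0
  have seg: "c + t *\<^sub>R (x - c) \<in> B" if "x \<in> B" "t \<in> {0..1}" for x t
    using convexD_alt[OF assms(2,3) that(1), of t] that(2) by (simp add: algebra_simps)
  have "continuous_on (B \<times> cbox 0 1) (\<lambda>(x, t). t ^ m * F (c + t *\<^sub>R (x - c)))"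
    unfolding split_def
    by (intro continuous_intros continuous_on_compose2[OF 0[unfolded Ck_on.simps]]) (use seg in auto)
  then show ?case
    using integral_continuous_on_param[of B 0 1 "\<lambda>x t. t ^ m * F (c + t *\<^sub>R (x - c))"] by simp
next
  case (Suc k)
  have seg: "c + t *\<^sub>R (x - c) \<in> B" if "x \<in> B" "t \<in> {0..1}" for x t
    using convexD_alt[OF assms(2,3) that(1), of t] that(2) by (simp add: algebra_simps)
  let ?F' = "\<lambda>x. frechet_derivative F (at x)"
  note F' = Ck_on_SucD[OF assms(1) Suc.prems]
  \<comment> \<open>The derivative of the integrand in x, with the chain rule factor already inside
    t^(m+1). It is bundled as a bounded linear function because the Leibniz rule asks for joint
    continuity in that space.\<close>
  define G where "G x t = (t ^ Suc m) *\<^sub>R Blinfun (?F' (c + t *\<^sub>R (x - c)))" for x t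
  have G: "blinfun_apply (G x t) b = t ^ Suc m * ?F' (c + t *\<^sub>R (x - c)) b"
    if "x \<in> B" "t \<in> {0..1}" for x t b
    unfolding G_def using F'(1)[OF seg[OF that]]
    by (simp add: scaleR_blinfun.rep_eq bounded_linear_Blinfun_apply has_derivative_bounded_linear)
  have cont: "continuous_on (B \<times> cbox 0 1) (\<lambda>(x, t). G x t)"
  proof (rule continuous_on_blinfun_componentwise)
    fix b :: 'e assume b: "b \<in> Basis"
    have "continuous_on (B \<times> cbox 0 1) (\<lambda>(x, t). t ^ Suc m * ?F' (c + t *\<^sub>R (x - c)) b)"
      unfolding split_def
      by (intro continuous_intros continuous_on_compose2[OF Ck_on_continuous[OF assms(1) F'(2)[OF b]]])
        (use seg in auto)
    then show "continuous_on (B \<times> cbox 0 1) (\<lambda>z. blinfun_apply (case z of (x, t) \<Rightarrow> G x t) b)"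
      by (rule continuous_on_eq) (use G in auto)
  qed
  have contF: "continuous_on {0..1} (\<lambda>t. t ^ m * F (c + t *\<^sub>R (x - c)))" if "x \<in> B" for x
    by (intro continuous_intros continuous_on_compose2[OF Ck_on_continuous[OF assms(1) Suc.prems]])
      (use seg that in auto)
  have der: "((\<lambda>x. t ^ m * F (c + t *\<^sub>R (x - c))) has_derivative blinfun_apply (G x t)) (at x within B)"
    if "x \<in> B" "t \<in> cbox 0 1" for x t
  proof -
    have "((\<lambda>x. c + t *\<^sub>R (x - c)) has_derivative (\<lambda>b. t *\<^sub>R b)) (at x)"
      by (auto intro!: derivative_eq_intros)
    from has_derivative_compose[OF this F'(1)[OF seg]] that
    have "((\<lambda>x. t ^ m * F (c + t *\<^sub>R (x - c))) has_derivative
        (\<lambda>b. t ^ m * ?F' (c + t *\<^sub>R (x - c)) (t *\<^sub>R b))) (at x)"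
      by (auto intro!: has_derivative_mult_right)
    moreover have "linear (?F' (c + t *\<^sub>R (x - c)))"
      using has_derivative_linear[OF F'(1)[OF seg]] that by auto
    ultimately have "((\<lambda>x. t ^ m * F (c + t *\<^sub>R (x - c))) has_derivative blinfun_apply (G x t)) (at x)"
      using that by (elim has_derivative_eq_rhs) (simp add: fun_eq_iff G linear_cmul)
    then show ?thesis by (rule has_derivative_at_withinI)
  qed
  have int: "((\<lambda>x. integral {0..1} (\<lambda>t. t ^ m * F (c + t *\<^sub>R (x - c)))) has_derivative
      blinfun_apply (integral {0..1} (G x))) (at x)" if x: "x \<in> B" for x
  proof -
    have "(\<lambda>t. t ^ m * F (c + t *\<^sub>R (x - c))) integrable_on cbox 0 1" if "x \<in> B" for x
      unfolding cbox_interval using contF[OF that] by (rule integrable_continuous_real)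
    from leibniz_rule[OF der this cont x assms(2)] show ?thesis
      unfolding cbox_interval at_within_open[OF x assms(1)] .
  qed
  have app: "blinfun_apply (integral {0..1} (G x)) b = integral {0..1} (\<lambda>t. t ^ Suc m * ?F' (c + t *\<^sub>R (x - c)) b)"
    if x: "x \<in> B" for x b
  proof -
    have "continuous_on {0..1} (\<lambda>t. (\<lambda>(x, t). G x t) (x, t))"
      by (rule continuous_on_compose2[OF cont]) (auto intro!: continuous_intros simp: x)
    then have "(G x) integrable_on {0..1}" by (simp add: integrable_continuous_real)
    from integral_linear[OF this blinfun.bounded_linear_left, of b]
    have "blinfun_apply (integral {0..1} (G x)) b = integral {0..1} (\<lambda>t. blinfun_apply (G x t) b)"
      by (simp add: o_def)
    also have "\<dots> = integral {0..1} (\<lambda>t. t ^ Suc m * ?F' (c + t *\<^sub>R (x - c)) b)"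
      by (rule integral_cong) (use G x in auto)
    finally show ?thesis .
  qed
  show ?case
  proof (rule Ck_on_SucI[OF assms(1) int])
    show "Ck_on k B (\<lambda>x. blinfun_apply (integral {0..1} (G x)) b)" if "b \<in> Basis" for b
      by (rule iffD2[OF Ck_on_cong[OF app] Suc.IH[OF F'(2)[OF that]]])
  qed
qed

text \<open>f x - f c is the integral over [0,1] of the derivative of f (c + t (x - c)) in t, which
  is linear in x - c and so splits along \<open>Basis\<close>. At x = c the integrands are constant,
  which gives the values of the \<open>g i\<close> there.\<close>

lemma Hadamard_lemma:
  fixes f :: "'e::euclidean_space \<Rightarrow> real"
  assumes "open B" "convex B" "c \<in> B" "smooth_on B f"
  obtains g where "\<And>i. i \<in> Basis \<Longrightarrow> smooth_on B (g i)"
    "\<And>x. x \<in> B \<Longrightarrow> f x = f c + (\<Sum>i\<in>Basis. ((x - c) \<bullet> i) * g i x)"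
    "\<And>i. g i c = frechet_derivative f (at c) i"
proof
  let ?f' = "\<lambda>x. frechet_derivative f (at x)"
  have f': "(f has_derivative ?f' x) (at x)" if "x \<in> B" for x
    using assms(4) Ck_on_SucD(1)[OF assms(1) _ that] unfolding smooth_on_def by blast
  have cont: "continuous_on B (\<lambda>x. ?f' x i)" if "i \<in> Basis" for i
    using smooth_on_frechet[OF assms(1,4) that] Ck_on_continuous[OF assms(1)] unfolding smooth_on_def by blast
  have seg: "c + t *\<^sub>R (x - c) \<in> B" if "x \<in> B" "t \<in> {0..1}" for x t
    using convexD_alt[OF assms(2,3) that(1), of t] that(2) by (simp add: algebra_simps)
  \<comment> \<open>The idle factor \<open>t ^ 0\<close> makes this the case m = 0 of
    \<open>Ck_on_segment_integral\<close>.\<close>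
  let ?g = "\<lambda>i x. integral {0..1} (\<lambda>t. t ^ 0 * ?f' (c + t *\<^sub>R (x - c)) i)"
  show "smooth_on B (?g i)" if "i \<in> Basis" for i
    using Ck_on_segment_integral[OF assms(1-3), of _ "\<lambda>x. ?f' x i" 0] smooth_on_frechet[OF assms(1,4) that]
    unfolding smooth_on_def by blast
  show "?g i c = ?f' c i" for i by simp
  show "f x = f c + (\<Sum>i\<in>Basis. ((x - c) \<bullet> i) * ?g i x)" if x: "x \<in> B" for x
  proof -
    have exp: "?f' y (x - c) = (\<Sum>i\<in>Basis. ((x - c) \<bullet> i) * ?f' y i)" if "y \<in> B" for y
    proof -
      interpret l: linear "?f' y" by (rule has_derivative_linear[OF f'[OF that]])
      have "?f' y (x - c) = ?f' y (\<Sum>i\<in>Basis. ((x - c) \<bullet> i) *\<^sub>R i)"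
        by (simp only: euclidean_representation)
      then show ?thesis by (simp add: l.sum l.scaleR)
    qed
    have "((\<lambda>t. f (c + t *\<^sub>R (x - c))) has_vector_derivative ?f' (c + t *\<^sub>R (x - c)) (x - c)) (at t within {0..1})"
      if t: "t \<in> {0..1}" for t
    proof -
      have "((\<lambda>t. c + t *\<^sub>R (x - c)) has_derivative (\<lambda>s. s *\<^sub>R (x - c))) (at t within {0..1})"
        by (auto intro!: derivative_eq_intros)
      from has_derivative_compose[OF this f'[OF seg[OF x t]]]
      show ?thesis unfolding has_vector_derivative_def
        using linear_cmul[OF has_derivative_linear[OF f'[OF seg[OF x t]]]] by simp
    qed
    from fundamental_theorem_of_calculus[OF _ this]
    have "((\<lambda>t. ?f' (c + t *\<^sub>R (x - c)) (x - c)) has_integral f x - f c) {0..1}" by simp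
    moreover have "((\<lambda>t. ?f' (c + t *\<^sub>R (x - c)) (x - c)) has_integral
        (\<Sum>i\<in>Basis. ((x - c) \<bullet> i) * ?g i x)) {0..1}"
    proof -
      have "((\<lambda>t. \<Sum>i\<in>Basis. ((x - c) \<bullet> i) * (t ^ 0 * ?f' (c + t *\<^sub>R (x - c)) i)) has_integral
          (\<Sum>i\<in>Basis. ((x - c) \<bullet> i) * ?g i x)) {0..1}"
      proof (intro has_integral_sum has_integral_mult_right integrable_integral integrable_continuous_real finite_Basis)
        fix i :: 'e assume i: "i \<in> Basis"
        show "continuous_on {0..1} (\<lambda>t. t ^ 0 * ?f' (c + t *\<^sub>R (x - c)) i)"
          by (intro continuous_intros continuous_on_compose2[OF cont[OF i]]) (use seg x in auto)
      qed
      then show ?thesis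
        by (rule has_integral_eq[rotated]) (use exp seg x in auto)
    qed
    ultimately have "f x - f c = (\<Sum>i\<in>Basis. ((x - c) \<bullet> i) * ?g i x)" by (rule has_integral_unique)
    then show ?thesis by simp
  qed
qed

section \<open>Smooth functions and local frames\<close>

lemma sum_fun_apply: "(\<Sum>i\<in>I. g i) x = (\<Sum>i\<in>I. g i x)"
  by (induction I rule: infinite_finite_induct) simp_all

lemma scaleR_fun_apply [simp]: "(c *\<^sub>R f) x = c *\<^sub>R f x"
  by (simp add: scaleR_fun_def)

lemma smul_apply [simp]: "smul f X p = f p *\<^sub>R X p"
  by (simp add: smul_def)

locale smooth_manifold =
  fixes A :: "('a::{t2_space,second_countable_topology}, 'e::euclidean_space) atlas"
  assumes atlas: "smooth_atlas A"
begin

abbreviation R where "R \<equiv> smooth_functions A"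
abbreviation T where "T \<equiv> tangent_space A"
abbreviation VF where "VF \<equiv> vector_fields A"

section \<open>Charts and the case of dimension zero\<close>

lemmas atlasD =
  atlas[unfolded smooth_atlas_def, THEN conjunct1]
  atlas[unfolded smooth_atlas_def, THEN conjunct2, THEN conjunct1]
  atlas[unfolded smooth_atlas_def, THEN conjunct2, THEN conjunct2, THEN conjunct1]
  atlas[unfolded smooth_atlas_def, THEN conjunct2, THEN conjunct2, THEN conjunct2]

lemma chart_ex:
  fixes p :: 'a
  obtains U \<phi> where "(U, \<phi>) \<in> A" "p \<in> U"
proof -
  have "p \<in> (\<Union>(U, \<phi>)\<in>A. U)" unfolding atlasD(1) by (rule UNIV_I)
  then show thesis using that by auto
qed

text \<open>The atlas only provides some inverse \<psi> of each chart; on the image it coincides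
  with \<open>inv_into U \<phi>\<close>, the map in which smoothness is expressed.\<close>

lemma chart:
  assumes "(U, \<phi>) \<in> A"
  shows "open U" "homeomorphism U (\<phi> ` U) \<phi> (inv_into U \<phi>)" "inj_on \<phi> U"
proof -
  obtain \<psi> where \<psi>: "homeomorphism U (\<phi> ` U) \<phi> \<psi>" and "open U"
    using assms atlasD(2) by fast
  then show "open U" by simp
  show inj: "inj_on \<phi> U" using \<psi> by (metis homeomorphism_apply1 inj_onI)
  have "inv_into U \<phi> y = \<psi> y" if "y \<in> \<phi> ` U" for y
    using \<psi> inj that by (auto simp: homeomorphism_apply1)
  then show "homeomorphism U (\<phi> ` U) \<phi> (inv_into U \<phi>)"
    using homeomorphism_cong[OF \<psi> refl refl refl] by simp
qed

lemma smooth_on_trivial: "V \<subseteq> {0} \<Longrightarrow> smooth_on V g"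
  unfolding smooth_on_def by (intro allI Ck_on_trivial)

text \<open>In dimension zero, every function is smooth and \<open>M\<close> is discrete.\<close>

definition zero_dim :: bool where "zero_dim \<longleftrightarrow> \<not> (\<forall>(U, \<phi>)\<in>A. open (\<phi> ` U))"

lemma open_chart: "\<not> zero_dim \<Longrightarrow> (U, \<phi>) \<in> A \<Longrightarrow> open (\<phi> ` U)"
  unfolding zero_dim_def by auto

lemma zero_dim_charts: "zero_dim \<Longrightarrow> (U, \<phi>) \<in> A \<Longrightarrow> \<phi> ` U \<subseteq> {0}"
proof -
  assume zero_dim and A: "(U, \<phi>) \<in> A"
  then have "\<forall>(U, \<phi>)\<in>A. \<phi> ` U \<subseteq> {0}"
    using atlasD(3) unfolding zero_dim_def by satx
  from bspec[OF this A] show "\<phi> ` U \<subseteq> {0}" by simp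
qed

lemma zero_dim_R: "zero_dim \<Longrightarrow> f \<in> R"
  unfolding smooth_functions_def by (auto intro: smooth_on_trivial[OF zero_dim_charts])

lemma zero_dim_open:
  assumes zero_dim
  shows "open {p :: 'a}"
proof -
  obtain U \<phi> where U: "(U, \<phi>) \<in> A" "p \<in> U" by (rule chart_ex)
  have "q = p" if "q \<in> U" for q
  proof (rule inj_onD[OF chart(3)[OF U(1)] _ that U(2)])
    show "\<phi> q = \<phi> p" using zero_dim_charts[OF assms U(1)] that U(2) by (metis image_subset_iff singletonD)
  qed
  then have "U = {p}" using U(2) by blast
  then show ?thesis using chart(1)[OF U(1)] by simp
qed

section \<open>The algebra of smooth functions\<close>

lemma R_iff: "f \<in> R \<longleftrightarrow> (\<forall>(U, \<phi>)\<in>A. smooth_on (\<phi> ` U) (\<lambda>x. f (inv_into U \<phi> x)))"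
  unfolding smooth_functions_def by (simp add: o_def)

lemma R_D: "f \<in> R \<Longrightarrow> (U, \<phi>) \<in> A \<Longrightarrow> smooth_on (\<phi> ` U) (\<lambda>x. f (inv_into U \<phi> x))"
  unfolding R_iff by blast

lemma R_const: "(\<lambda>q. c) \<in> R"
  by (cases zero_dim, simp add: zero_dim_R) (auto simp: R_iff smooth_on_def open_chart intro!: Ck_on_const)

lemma R_add: "f \<in> R \<Longrightarrow> g \<in> R \<Longrightarrow> (\<lambda>q. f q + g q) \<in> R"
  by (cases zero_dim, simp add: zero_dim_R) (auto simp: R_iff smooth_on_def open_chart intro!: Ck_on_add)

lemma R_mult: "f \<in> R \<Longrightarrow> g \<in> R \<Longrightarrow> (\<lambda>q. f q * g q) \<in> R"
  by (cases zero_dim, simp add: zero_dim_R) (auto simp: R_iff smooth_on_def open_chart intro!: Ck_on_mult)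

lemma R_uminus: "f \<in> R \<Longrightarrow> (\<lambda>q. - f q) \<in> R"
  using R_mult[OF R_const[of "- 1"]] by simp

lemma R_diff: "f \<in> R \<Longrightarrow> g \<in> R \<Longrightarrow> (\<lambda>q. f q - g q) \<in> R"
  using R_add[OF _ R_uminus] by simp

lemma R_sum: "(\<And>i. i \<in> I \<Longrightarrow> f i \<in> R) \<Longrightarrow> (\<lambda>q. \<Sum>i\<in>I. f i q) \<in> R"
  by (induction I rule: infinite_finite_induct) (simp_all add: R_const R_add)

section \<open>Transport along charts, extension by zero and cut-offs\<close>

lemma open_image:
  assumes "\<not> zero_dim" "(U, \<phi>) \<in> A" "open S" "S \<subseteq> U"
  shows "open (\<phi> ` S)"
proof -
  have "openin (top_of_set (\<phi> ` U)) (\<phi> ` S)"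
    using homeomorphism_imp_open_map[OF chart(2)[OF assms(2)]] assms(3,4)
    by (metis open_subset)
  then show ?thesis using open_chart[OF assms(1,2)] openin_open_trans by blast
qed

lemma open_preimage:
  assumes "(U, \<phi>) \<in> A" "open S"
  shows "open {q \<in> U. \<phi> q \<in> S}"
proof -
  have "continuous_on U \<phi>" using chart(2)[OF assms(1)] homeomorphism_cont1 by blast
  then have "open (\<phi> -` S \<inter> U)"
    using continuous_on_open_vimage[OF chart(1)[OF assms(1)]] assms(2) by blast
  then show ?thesis by (simp add: vimage_def Int_def conj_commute)
qed

text \<open>The gluing principle of this development: the local models are themselves global smooth
  functions. It is what converts statements about germs into smoothness.\<close>

lemma R_local:
  assumes "\<And>p. \<exists>g\<in>R. \<forall>\<^sub>F q in nhds p. f q = g q"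
  shows "f \<in> R"
proof (cases zero_dim)
  case False
  have "smooth_on (\<phi> ` U) (\<lambda>x. f (inv_into U \<phi> x))" if U: "(U, \<phi>) \<in> A" for U \<phi>
    unfolding smooth_on_def
  proof (intro allI Ck_on_local open_chart False U)
    fix k x assume "x \<in> \<phi> ` U"
    then obtain p where p: "p \<in> U" "x = \<phi> p" by blast
    obtain g N where g: "g \<in> R" "open N" "p \<in> N" "\<And>q. q \<in> N \<Longrightarrow> f q = g q"
      using assms[of p] unfolding eventually_nhds by blast
    let ?W = "\<phi> ` (U \<inter> N)"
    have o: "open ?W" by (rule open_image[OF False U]) (use chart(1)[OF U] g in auto)
    have "Ck_on k ?W (\<lambda>x. g (inv_into U \<phi> x))"
      using R_D[OF g(1) U] Ck_on_subset[OF open_chart[OF False U] _ o] unfolding smooth_on_def by blast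
    moreover have "f (inv_into U \<phi> y) = g (inv_into U \<phi> y)" if "y \<in> ?W" for y
      using that chart(3)[OF U] g(4) by auto
    ultimately have "Ck_on k ?W (\<lambda>x. f (inv_into U \<phi> x))" by (subst Ck_on_cong)
    then show "\<exists>W. open W \<and> x \<in> W \<and> Ck_on k W (\<lambda>x. f (inv_into U \<phi> x))"
      using o p g(3) by blast
  qed
  then show ?thesis unfolding R_iff by blast
qed (simp add: zero_dim_R)

text \<open>Two open sets cover M: the preimage of V, where the function is \<open>g\<close> seen
  through a change of charts, and the complement of the preimage of K, where it is 0.\<close>

lemma R_extend:
  assumes nz: "\<not> zero_dim" and U: "(U, \<phi>) \<in> A" and V: "open V" "V \<subseteq> \<phi> ` U"
    and K: "compact K" "K \<subseteq> V" and g: "smooth_on V g" "\<And>x. x \<in> V \<Longrightarrow> x \<notin> K \<Longrightarrow> g x = 0"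
  shows "(\<lambda>q. if q \<in> U \<and> \<phi> q \<in> V then g (\<phi> q) else 0) \<in> R" (is "?F \<in> R")
proof -
  let ?\<psi> = "inv_into U \<phi>"
  have "continuous_on K ?\<psi>"
    using chart(2)[OF U] homeomorphism_cont2 continuous_on_subset K(2) V(2) by (metis order_trans)
  \<comment> \<open>The Hausdorff property enters here: a compact subset of M is closed.\<close>
  then have closed: "closed (?\<psi> ` K)" by (simp add: compact_continuous_image compact_imp_closed K(1))
  have "smooth_on (\<phi>' ` U') (\<lambda>x. ?F (inv_into U' \<phi>' x))" if U': "(U', \<phi>') \<in> A" for U' \<phi>'
    unfolding smooth_on_def
  proof (intro allI Ck_on_local open_chart nz U')
    fix k x assume "x \<in> \<phi>' ` U'"
    then obtain p where p: "p \<in> U'" "x = \<phi>' p" by blast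
    let ?\<psi>' = "inv_into U' \<phi>'"
    show "\<exists>W. open W \<and> x \<in> W \<and> Ck_on k W (\<lambda>x. ?F (?\<psi>' x))"
    proof (cases "p \<in> U \<and> \<phi> p \<in> V")
      case True
      let ?N = "U' \<inter> {q \<in> U. \<phi> q \<in> V}"
      have o: "open (\<phi>' ` ?N)"
        by (rule open_image[OF nz U']) (use open_preimage[OF U V(1)] chart(1)[OF U'] in auto)
      have o2: "open (\<phi>' ` (U' \<inter> U))"
        by (rule open_image[OF nz U']) (use chart(1)[OF U] chart(1)[OF U'] in auto)
      have "smooth_on (\<phi>' ` (U' \<inter> U)) (\<phi> \<circ> ?\<psi>')"
        using atlasD(4) U U' by fast
      then have "Ck_on k (\<phi>' ` ?N) (\<lambda>x. \<phi> (?\<psi>' x))"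
        using Ck_on_subset[OF o2 _ o] unfolding smooth_on_def o_def by blast
      moreover have inv: "?\<psi>' (\<phi>' q) = q" if "q \<in> U'" for q using chart(3)[OF U'] that by simp
      ultimately have "Ck_on k (\<phi>' ` ?N) (\<lambda>x. g (\<phi> (?\<psi>' x)))"
        using g(1) by (intro Ck_on_compose[OF o V(1)]) (auto simp: smooth_on_def)
      moreover have "?F (?\<psi>' y) = g (\<phi> (?\<psi>' y))" if "y \<in> \<phi>' ` ?N" for y
        using that inv by auto
      ultimately have "Ck_on k (\<phi>' ` ?N) (\<lambda>x. ?F (?\<psi>' x))" by (subst Ck_on_cong)
      then show ?thesis using o p True by blast
    next
      case False
      let ?N = "U' \<inter> - (?\<psi> ` K)"
      have o: "open (\<phi>' ` ?N)"
        by (rule open_image[OF nz U']) (use closed chart(1)[OF U'] in auto)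
      have "?F (?\<psi>' y) = 0" if y: "y \<in> \<phi>' ` ?N" for y
      proof -
        obtain q where q: "q \<in> U'" "q \<notin> ?\<psi> ` K" "?\<psi>' y = q" using y chart(3)[OF U'] by auto
        have "\<phi> q \<notin> K" if "q \<in> U"
          using q(2) chart(3)[OF U] that by (metis image_eqI inv_into_f_f)
        then show ?thesis using g(2) q by auto
      qed
      then have "Ck_on k (\<phi>' ` ?N) (\<lambda>x. ?F (?\<psi>' x))"
        using Ck_on_const[OF o, of k "0 :: real"] by (subst Ck_on_cong)
      moreover have "p \<notin> ?\<psi> ` K"
      proof
        assume "p \<in> ?\<psi> ` K"
        then obtain y where y: "y \<in> K" "p = ?\<psi> y" by blast
        then have "y \<in> \<phi> ` U" using K(2) V(2) by blast
        then show False using False y K(2) by (metis f_inv_into_f inv_into_into subsetD)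
      qed
      ultimately show ?thesis using o p by blast
    qed
  qed
  then show ?thesis unfolding R_iff by blast
qed

text \<open>Delivers the cut-off as an operation on every smooth \<open>g\<close> on V at once: the
  results are global, and near p they agree with \<open>g\<close> read in the chart, since the bump
  is 1 on a ball there.\<close>

lemma bump_in_chart:
  assumes "\<not> zero_dim" "(U, \<phi>) \<in> A" "p \<in> U" "open V" "V \<subseteq> \<phi> ` U" "\<phi> p \<in> V"
  obtains u :: "'e \<Rightarrow> real" and r where "r > 0" "\<And>x. dist (\<phi> p) x \<le> r \<Longrightarrow> u x = 1" "ball (\<phi> p) r \<subseteq> V"
    "\<And>g. smooth_on V g \<Longrightarrow> (\<lambda>q. if q \<in> U \<and> \<phi> q \<in> V then u (\<phi> q) * g (\<phi> q) else 0) \<in> R"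
proof -
  obtain s where s: "s > 0" "cball (\<phi> p) s \<subseteq> V" using assms(4,6) open_contains_cball by blast
  obtain u :: "'e \<Rightarrow> real" where u: "smooth_on UNIV u" "\<And>x. dist (\<phi> p) x \<le> s / 2 \<Longrightarrow> u x = 1"
    "\<And>x. dist (\<phi> p) x \<ge> s \<Longrightarrow> u x = 0"
    using smooth_bump[of "s / 2" s "\<phi> p"] s(1) by auto
  have "Ck_on k V u" for k
    using u(1) Ck_on_subset[OF open_UNIV _ assms(4)] unfolding smooth_on_def by blast
  then have "smooth_on V (\<lambda>x. u x * g x)" if "smooth_on V g" for g
    using that Ck_on_mult[OF assms(4)] unfolding smooth_on_def by blast
  moreover have "ball (\<phi> p) (s / 2) \<subseteq> cball (\<phi> p) s"
    by (rule order_trans[OF ball_subset_cball subset_cball]) (use s in simp)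
  ultimately show thesis
    using s u(2,3) by (intro that[of "s / 2" u] R_extend[OF assms(1,2,4,5) compact_cball s(2)]) auto
qed

lemma R_bump:
  assumes "open N" "p \<in> N"
  obtains \<rho> where "\<rho> \<in> R" "\<rho> p = 1" "\<And>q. q \<notin> N \<Longrightarrow> \<rho> q = 0"
proof (cases zero_dim)
  case True
  then show thesis using assms by (intro that[of "\<lambda>q. if q \<in> N then 1 else 0"]) (auto simp: zero_dim_R)
next
  case False
  obtain U \<phi> where U: "(U, \<phi>) \<in> A" "p \<in> U" by (rule chart_ex)
  let ?V = "\<phi> ` (U \<inter> N)"
  have V: "open ?V" by (rule open_image[OF False U(1)]) (use chart(1)[OF U(1)] assms in auto)
  obtain u :: "'e \<Rightarrow> real" and r where u: "r > 0" "\<And>x. dist (\<phi> p) x \<le> r \<Longrightarrow> u x = 1"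
    "\<And>g. smooth_on ?V g \<Longrightarrow> (\<lambda>q. if q \<in> U \<and> \<phi> q \<in> ?V then u (\<phi> q) * g (\<phi> q) else 0) \<in> R"
    by (rule bump_in_chart[OF False U V]) (use assms U in blast)+
  show thesis
  proof (rule that)
    show "(\<lambda>q. if q \<in> U \<and> \<phi> q \<in> ?V then u (\<phi> q) * 1 else 0) \<in> R"
      by (rule u(3)) (simp add: smooth_on_def Ck_on_const V)
    show "(if p \<in> U \<and> \<phi> p \<in> ?V then u (\<phi> p) * 1 else 0) = 1" using u(1,2) U assms by auto
    show "(if q \<in> U \<and> \<phi> q \<in> ?V then u (\<phi> q) * 1 else 0) = 0" if "q \<notin> N" for q
      using that chart(3)[OF U(1)] by (auto dest: inj_onD)
  qed
qed

text \<open>Only the germ at p is inverted, since \<open>g\<close> may vanish elsewhere: 1/g is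
  smooth on the open set where \<open>g\<close> is non-zero in a chart, and is cut off inside
  it.\<close>

lemma R_inverse:
  assumes "g \<in> R" "g p \<noteq> 0"
  obtains g' where "g' \<in> R" "\<forall>\<^sub>F q in nhds p. g' q * g q = 1"
proof (cases zero_dim)
  case True
  have "\<forall>\<^sub>F q in nhds p. inverse (g q) * g q = 1"
    by (rule eventually_mono[OF eventually_nhds_in_open[OF zero_dim_open[OF True] singletonI]])
      (use assms(2) in simp)
  then show thesis by (rule that[OF zero_dim_R[OF True]])
next
  case False
  obtain U \<phi> where U: "(U, \<phi>) \<in> A" "p \<in> U" by (rule chart_ex)
  let ?g = "\<lambda>x. g (inv_into U \<phi> x)"
  let ?V = "{x \<in> \<phi> ` U. ?g x \<noteq> 0}"
  note oU = open_chart[OF False U(1)]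
  have inv: "inv_into U \<phi> (\<phi> q) = q" if "q \<in> U" for q using chart(3)[OF U(1)] that by simp
  have gs: "smooth_on (\<phi> ` U) ?g" by (rule R_D[OF assms(1) U(1)])
  then have "continuous_on (\<phi> ` U) ?g" using Ck_on_continuous[OF oU] unfolding smooth_on_def by blast
  then have "open (?g -` (- {0}) \<inter> \<phi> ` U)" using continuous_on_open_vimage[OF oU] by blast
  then have V: "open ?V" by (simp add: vimage_def Int_def conj_commute)
  have "Ck_on k ?V ?g" for k using gs Ck_on_subset[OF oU _ V] unfolding smooth_on_def by blast
  then have gi: "smooth_on ?V (\<lambda>x. inverse (?g x))"
    using Ck_on_inverse[OF V] unfolding smooth_on_def by blast
  have pV: "\<phi> p \<in> ?V" using U assms(2) inv by simp
  obtain u :: "'e \<Rightarrow> real" and r where u: "r > 0" "\<And>x. dist (\<phi> p) x \<le> r \<Longrightarrow> u x = 1" "ball (\<phi> p) r \<subseteq> ?V"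
    "\<And>g. smooth_on ?V g \<Longrightarrow> (\<lambda>q. if q \<in> U \<and> \<phi> q \<in> ?V then u (\<phi> q) * g (\<phi> q) else 0) \<in> R"
    by (rule bump_in_chart[OF False U V _ pV]) blast+
  have "\<forall>\<^sub>F q in nhds p. q \<in> {q \<in> U. \<phi> q \<in> ball (\<phi> p) r}"
    by (rule eventually_nhds_in_open[OF open_preimage[OF U(1) open_ball]]) (use U u(1) in simp)
  then have "\<forall>\<^sub>F q in nhds p. (if q \<in> U \<and> \<phi> q \<in> ?V then u (\<phi> q) * inverse (?g (\<phi> q)) else 0) * g q = 1"
  proof (rule eventually_mono)
    fix q assume q: "q \<in> {q \<in> U. \<phi> q \<in> ball (\<phi> p) r}"
    then have "\<phi> q \<in> ?V" "u (\<phi> q) = 1" using u(2,3) by auto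
    then show "(if q \<in> U \<and> \<phi> q \<in> ?V then u (\<phi> q) * inverse (?g (\<phi> q)) else 0) * g q = 1"
      using q inv by auto
  qed
  then show thesis by (rule that[OF u(4)[OF gi]])
qed

section \<open>Tangent vectors, vector fields and local frames\<close>

lemma T_iff: "v \<in> T p \<longleftrightarrow>
    (\<forall>f\<in>R. \<forall>g\<in>R. v (\<lambda>q. f q + g q) = v f + v g) \<and>
    (\<forall>c. \<forall>f\<in>R. v (\<lambda>q. c * f q) = c * v f) \<and>
    (\<forall>f\<in>R. \<forall>g\<in>R. v (\<lambda>q. f q * g q) = v f * g p + f p * v g) \<and>
    (\<forall>f. f \<notin> R \<longrightarrow> v f = 0)"
  unfolding tangent_space_def by (simp add: func_plus func_times scaleR_fun_def)

lemma
  assumes "v \<in> T p"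
  shows T_add: "f \<in> R \<Longrightarrow> g \<in> R \<Longrightarrow> v (\<lambda>q. f q + g q) = v f + v g"
    and T_scale: "f \<in> R \<Longrightarrow> v (\<lambda>q. c * f q) = c * v f"
    and T_mult: "f \<in> R \<Longrightarrow> g \<in> R \<Longrightarrow> v (\<lambda>q. f q * g q) = v f * g p + f p * v g"
    and T_out: "f \<notin> R \<Longrightarrow> v f = 0"
  using assms unfolding T_iff by blast+

text \<open>Leibniz on 1 = 1 * 1 gives v(1) = 2 v(1).\<close>

lemma T_const: "v \<in> T p \<Longrightarrow> v (\<lambda>q. c) = 0"
  using T_mult[of v p "\<lambda>q. 1" "\<lambda>q. 1"] T_scale[of v p "\<lambda>q. 1" c] R_const[of 1] by simp

lemma T_uminus: "v \<in> T p \<Longrightarrow> f \<in> R \<Longrightarrow> v (\<lambda>q. - f q) = - v f"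
  using T_scale[of v p f "- 1"] by simp

lemma T_diff: "v \<in> T p \<Longrightarrow> f \<in> R \<Longrightarrow> g \<in> R \<Longrightarrow> v (\<lambda>q. f q - g q) = v f - v g"
  using T_add[of v p f "\<lambda>q. - g q"] T_uminus[of v p g] R_uminus[of g] by simp

lemma T_sum:
  assumes "v \<in> T p" "\<And>i. i \<in> I \<Longrightarrow> f i \<in> R"
  shows "v (\<lambda>q. \<Sum>i\<in>I. f i q) = (\<Sum>i\<in>I. v (f i))"
  using assms(2)
  by (induction I rule: infinite_finite_induct) (simp_all add: T_const[OF assms(1)] T_add[OF assms(1)] R_sum)

text \<open>The indicator \<open>e\<close> of p is smooth and idempotent, so v(e) = 2 v(e), that is
  v(e) = 0. Applying v to f e = f(p) e then gives v(f) = 0.\<close>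

lemma T_zero_dim:
  assumes zero_dim "v \<in> T p"
  shows "v f = 0"
proof -
  note R = zero_dim_R[OF assms(1)]
  define e where "e q = (if q = p then 1 else 0 :: real)" for q
  have "v (\<lambda>q. e q * e q) = 2 * v e" using T_mult[OF assms(2) R R, of e e] by (simp add: e_def)
  moreover have "(\<lambda>q. e q * e q) = e" by (auto simp: e_def)
  ultimately have e: "v e = 0" by simp
  have "v (\<lambda>q. f q * e q) = v f" using T_mult[OF assms(2) R R, of f e] e by (simp add: e_def)
  moreover have "(\<lambda>q. f q * e q) = (\<lambda>q. f p * e q)" by (auto simp: e_def)
  ultimately show ?thesis using T_scale[OF assms(2) R, of "f p" e] e by simp
qed

lemma VF_D: "X \<in> VF \<Longrightarrow> X p \<in> T p" "X \<in> VF \<Longrightarrow> f \<in> R \<Longrightarrow> (\<lambda>p. X p f) \<in> R"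
  unfolding vector_fields_def by auto

lemma VF_I: "(\<And>p. X p \<in> T p) \<Longrightarrow> (\<And>f. f \<in> R \<Longrightarrow> (\<lambda>p. X p f) \<in> R) \<Longrightarrow> X \<in> VF"
  unfolding vector_fields_def by auto

text \<open>The fields are partial derivatives and the functions are coordinates, both multiplied by
  a bump that is 1 on W. Hadamard's lemma, centred at each q in W, shows that a derivation at q is
  determined by its values on the \<open>x i\<close>.\<close>

lemma coordinate_frame:
  fixes p :: 'a
  assumes nz: "\<not> zero_dim"
  obtains W and E :: "'e \<Rightarrow> 'a \<Rightarrow> 'a tvec" and x where "open W" "p \<in> W"
    "\<And>i. i \<in> Basis \<Longrightarrow> E i \<in> VF" "\<And>i. i \<in> Basis \<Longrightarrow> x i \<in> R"
    "\<And>q v f. q \<in> W \<Longrightarrow> v \<in> T q \<Longrightarrow> v f = (\<Sum>i\<in>Basis. v (x i) * E i q f)"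
    "\<And>q i j. q \<in> W \<Longrightarrow> i \<in> Basis \<Longrightarrow> j \<in> Basis \<Longrightarrow> E i q (x j) = (if i = j then 1 else 0)"
proof -
  obtain U \<phi> where U: "(U, \<phi>) \<in> A" "p \<in> U" by (rule chart_ex)
  let ?V = "\<phi> ` U" and ?\<psi> = "inv_into U \<phi>"
  note V = open_chart[OF nz U(1)]
  have inv: "?\<psi> (\<phi> q) = q" if "q \<in> U" for q using chart(3)[OF U(1)] that by simp
  obtain u :: "'e \<Rightarrow> real" and r where u: "r > 0" "\<And>x. dist (\<phi> p) x \<le> r \<Longrightarrow> u x = 1" "ball (\<phi> p) r \<subseteq> ?V"
    "\<And>g. smooth_on ?V g \<Longrightarrow> (\<lambda>q. if q \<in> U \<and> \<phi> q \<in> ?V then u (\<phi> q) * g (\<phi> q) else 0) \<in> R"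
    by (rule bump_in_chart[OF nz U V order_refl imageI[OF U(2)]]) blast
  have uR: "(\<lambda>q. if q \<in> U then u (\<phi> q) * g (\<phi> q) else 0) \<in> R" if "smooth_on ?V g" for g
  proof -
    have "(\<lambda>q. if q \<in> U \<and> \<phi> q \<in> ?V then u (\<phi> q) * g (\<phi> q) else 0) =
        (\<lambda>q. if q \<in> U then u (\<phi> q) * g (\<phi> q) else 0)" by auto
    then show ?thesis using u(4)[OF that] by simp
  qed
  define d where "d i f y = frechet_derivative (\<lambda>y. f (?\<psi> y)) (at y) i"
    for i :: 'e and f :: "'a \<Rightarrow> real" and y
  have der: "((\<lambda>y. f (?\<psi> y)) has_derivative (\<lambda>i. d i f y)) (at y)" if "f \<in> R" "y \<in> ?V" for f y
    unfolding d_def using Ck_on_SucD(1)[OF V _ that(2)] R_D[OF that(1) U(1)] unfolding smooth_on_def by blast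
  have d_eq: "d i f y = f' i" if "((\<lambda>y. f (?\<psi> y)) has_derivative f') (at y)" for i f f' y
    unfolding d_def using frechet_derivative_at[OF that] by simp
  \<comment> \<open>The factor u makes the field global. The condition f \<in> R implements the
    convention that tangent vectors vanish on functions that are not smooth.\<close>
  define E where "E i q f = (if q \<in> U \<and> f \<in> R then u (\<phi> q) * d i f (\<phi> q) else 0)" for i q f
  define x where "x i q = (if q \<in> U then u (\<phi> q) * (\<phi> q \<bullet> i) else 0)" for i q
  define W where "W = {q \<in> U. \<phi> q \<in> ball (\<phi> p) r}"
  have uW: "u (\<phi> q) = 1" "q \<in> U" if "q \<in> W" for q using that u(2) unfolding W_def by auto
  have E_T: "E i q \<in> T q" for i q
  proof (cases "q \<in> U")
    case True
    then have y: "\<phi> q \<in> ?V" by simp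
    show ?thesis
      unfolding T_iff
    proof (intro conjI ballI allI impI)
      fix f g assume f: "f \<in> R" and g: "g \<in> R"
      show "E i q (\<lambda>q. f q + g q) = E i q f + E i q g"
        using d_eq[OF has_derivative_add[OF der[OF f y] der[OF g y]], of i] True f g R_add[OF f g]
        by (simp add: E_def algebra_simps)
      show "E i q (\<lambda>q. f q * g q) = E i q f * g q + f q * E i q g"
        using d_eq[OF has_derivative_mult[OF der[OF f y] der[OF g y]], of i] True f g R_mult[OF f g]
        by (simp add: E_def algebra_simps inv)
    next
      fix f c assume f: "f \<in> R"
      show "E i q (\<lambda>q. c * f q) = c * E i q f"
        using d_eq[OF has_derivative_mult_right[OF der[OF f y], of c], of i] True f R_mult[OF R_const f, of c]
        by (simp add: E_def algebra_simps)
    qed (simp add: E_def)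
  qed (simp add: T_iff E_def)
  have E_VF: "E i \<in> VF" if "i \<in> Basis" for i
  proof (rule VF_I[OF E_T])
    fix f assume f: "f \<in> R"
    have "smooth_on ?V (\<lambda>y. d i f y)"
      unfolding d_def by (rule smooth_on_frechet[OF V R_D[OF f U(1)] that])
    from uR[OF this] show "(\<lambda>q. E i q f) \<in> R" by (simp add: E_def f)
  qed
  have x_R: "x i \<in> R" for i
    using uR[of "\<lambda>y. y \<bullet> i"] Ck_on_linear[OF bounded_linear_inner_left V Ck_on_id[OF V]]
    by (simp add: x_def[abs_def] smooth_on_def)
  have E_x: "E i q (x j) = (if i = j then 1 else 0)" if "q \<in> W" "i \<in> Basis" "j \<in> Basis" for q i j
  proof -
    have "((\<lambda>y. x j (?\<psi> y)) has_derivative (\<lambda>b. b \<bullet> j)) (at (\<phi> q))"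
    proof (rule has_derivative_transform_within_open[OF _ open_ball])
      show "((\<lambda>y. y \<bullet> j) has_derivative (\<lambda>b. b \<bullet> j)) (at (\<phi> q))"
        by (rule bounded_linear_imp_has_derivative[OF bounded_linear_inner_left])
      show "\<phi> q \<in> ball (\<phi> p) r" using that(1) by (simp add: W_def)
      show "y \<bullet> j = x j (?\<psi> y)" if "y \<in> ball (\<phi> p) r" for y
      proof -
        have "y \<in> ?V" using that u(3) by blast
        then show ?thesis using u(2)[of y] that by (simp add: x_def inv_into_into f_inv_into_f)
      qed
    qed
    from d_eq[OF this, of i] show ?thesis
      using uW[OF that(1)] that(2,3) x_R by (simp add: E_def inner_Basis)
  qed
  have "v f = (\<Sum>i\<in>Basis. v (x i) * E i q f)" if q: "q \<in> W" and v: "v \<in> T q" for q v f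
  proof (cases "f \<in> R")
    case f: True
    let ?B = "ball (\<phi> p) r" and ?c = "\<phi> q"
    note qU = uW(2)[OF q]
    have cB: "?c \<in> ?B" using q by (simp add: W_def)
    have "smooth_on ?B (\<lambda>y. f (?\<psi> y))"
      using R_D[OF f U(1)] Ck_on_subset[OF V _ open_ball u(3)] unfolding smooth_on_def by blast
    from Hadamard_lemma[OF open_ball convex_ball cB this]
    obtain g where g: "\<And>i. i \<in> Basis \<Longrightarrow> smooth_on ?B (g i)"
      "\<And>y. y \<in> ?B \<Longrightarrow> f (?\<psi> y) = f (?\<psi> ?c) + (\<Sum>i\<in>Basis. ((y - ?c) \<bullet> i) * g i y)"
      "\<And>i. g i ?c = d i f ?c"
      unfolding d_def by blast
    \<comment> \<open>A second cut-off, now around q: the Hadamard factors \<open>g i\<close> depend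
      on q and are smooth on the ball only.\<close>
    obtain w :: "'e \<Rightarrow> real" and s where w: "s > 0" "\<And>y. dist ?c y \<le> s \<Longrightarrow> w y = 1"
      "\<And>g. smooth_on ?B g \<Longrightarrow> (\<lambda>q. if q \<in> U \<and> \<phi> q \<in> ?B then w (\<phi> q) * g (\<phi> q) else 0) \<in> R"
      by (rule bump_in_chart[OF nz U(1) qU open_ball u(3) cB]) blast
    define \<rho> where "\<rho> z = (if z \<in> U \<and> \<phi> z \<in> ?B then w (\<phi> z) * 1 else 0)" for z
    define G where "G i z = (if z \<in> U \<and> \<phi> z \<in> ?B then w (\<phi> z) * g i (\<phi> z) else 0)" for i z
    have \<rho>: "\<rho> \<in> R"
      unfolding \<rho>_def by (rule w(3)) (simp add: smooth_on_def Ck_on_const)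
    have G: "G i \<in> R" if "i \<in> Basis" for i
      unfolding G_def by (rule w(3)[OF g(1)[OF that]])
    have \<rho>q: "\<rho> q = 1" using w(1,2) qU cB by (simp add: \<rho>_def)
    have Gq: "G i q = E i q f" for i
      using w(1,2) qU cB f uW(1)[OF q] g(3) by (simp add: G_def E_def)
    have xq: "x i q = ?c \<bullet> i" for i using qU uW(1)[OF q] by (simp add: x_def)
    \<comment> \<open>Hadamard's formula multiplied by the cut-off, which makes it an identity
      between global smooth functions, to which v applies.\<close>
    have eq: "f z * \<rho> z = f q * \<rho> z + (\<Sum>i\<in>Basis. (x i z - x i q) * G i z)" for z
    proof (cases "z \<in> U \<and> \<phi> z \<in> ?B")
      case True
      then have "u (\<phi> z) = 1" using u(2) by simp
      then have "x i z = \<phi> z \<bullet> i" for i using True by (simp add: x_def)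
      moreover have "f z = f q + (\<Sum>i\<in>Basis. ((\<phi> z - ?c) \<bullet> i) * g i (\<phi> z))"
        using g(2)[of "\<phi> z"] True qU inv by simp
      ultimately show ?thesis
        using True by (simp add: \<rho>_def G_def xq algebra_simps sum_distrib_left inner_diff_left)
    next
      case False
      then have "\<rho> z = 0" "G i z = 0" for i by (auto simp: \<rho>_def G_def)
      then show ?thesis by simp
    qed
    have xd: "(\<lambda>z. x i z - x i q) \<in> R" for i by (rule R_diff[OF x_R R_const])
    have "v f + f q * v \<rho> = v (\<lambda>z. f z * \<rho> z)"
      using T_mult[OF v f \<rho>] \<rho>q by simp
    also have "(\<lambda>z. f z * \<rho> z) = (\<lambda>z. f q * \<rho> z + (\<Sum>i\<in>Basis. (x i z - x i q) * G i z))"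
      using eq by blast
    also have "v \<dots> = f q * v \<rho> + (\<Sum>i\<in>Basis. v (\<lambda>z. (x i z - x i q) * G i z))"
      by (simp add: T_add[OF v] T_scale[OF v] T_sum[OF v] R_sum R_mult R_const \<rho> G xd)
    \<comment> \<open>The first factor of each product vanishes at q, so Leibniz leaves v(x i) times
      the value of \<open>G i\<close> at q, which is the partial derivative.\<close>
    also have "(\<Sum>i\<in>Basis. v (\<lambda>z. (x i z - x i q) * G i z)) = (\<Sum>i\<in>Basis. v (x i) * E i q f)"
    proof (rule sum.cong[OF refl])
      fix i :: 'e assume i: "i \<in> Basis"
      show "v (\<lambda>z. (x i z - x i q) * G i z) = v (x i) * E i q f"
        using T_mult[OF v xd G[OF i], of i] T_diff[OF v x_R R_const, of i "x i q"] T_const[OF v, of "x i q"]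
        by (simp add: Gq)
    qed
    finally show ?thesis by simp
  next
    case False
    then show ?thesis using T_out[OF v False] T_out[OF E_T] by simp
  qed
  moreover have "open W" unfolding W_def by (rule open_preimage[OF U(1) open_ball])
  moreover have "p \<in> W" using U u(1) by (simp add: W_def)
  ultimately show thesis using that E_VF x_R E_x by blast
qed

text \<open>Dimension zero joins in with an empty index set, since all tangent vectors vanish there.
  Most later arguments then need no case distinction.\<close>

lemma frame:
  fixes p :: 'a
  obtains W and I :: "'e set" and E :: "'e \<Rightarrow> 'a \<Rightarrow> 'a tvec" and x where
    "open W" "p \<in> W" "I = Basis \<or> I = {}"
    "\<And>i. i \<in> I \<Longrightarrow> E i \<in> VF" "\<And>i. i \<in> I \<Longrightarrow> x i \<in> R"
    "\<And>q v f. q \<in> W \<Longrightarrow> v \<in> T q \<Longrightarrow> v f = (\<Sum>i\<in>I. v (x i) * E i q f)"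
    "\<And>q i j. q \<in> W \<Longrightarrow> i \<in> I \<Longrightarrow> j \<in> I \<Longrightarrow> E i q (x j) = (if i = j then 1 else 0)"
proof (cases zero_dim)
  case True
  show thesis
    by (rule that[of UNIV "{}"]) (simp_all add: T_zero_dim[OF True])
next
  case False
  show thesis
    by (rule coordinate_frame[OF False, of p]) (rule that[OF _ _ disjI1[OF refl]]; assumption)
qed

section \<open>Tensoriality\<close>

lemma T_zero: "0 \<in> T p"
  unfolding T_iff by simp

lemma T_plus: "u \<in> T p \<Longrightarrow> v \<in> T p \<Longrightarrow> u + v \<in> T p"
  unfolding T_iff by (simp add: algebra_simps)

lemma T_scaleR: "v \<in> T p \<Longrightarrow> c *\<^sub>R v \<in> T p"
  unfolding T_iff by (simp add: algebra_simps)

lemma T_minus: "u \<in> T p \<Longrightarrow> v \<in> T p \<Longrightarrow> u - v \<in> T p"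
  using T_plus[OF _ T_scaleR[of v p "- 1"]] by simp

lemma T_vsum: "(\<And>i. i \<in> I \<Longrightarrow> v i \<in> T p) \<Longrightarrow> (\<Sum>i\<in>I. v i) \<in> T p"
  by (induction I rule: infinite_finite_induct) (simp_all add: T_zero T_plus)

lemma T_linear_sum:
  fixes l :: "'a tvec \<Rightarrow> real"
  assumes "\<And>u v. u \<in> T p \<Longrightarrow> v \<in> T p \<Longrightarrow> l (u + v) = l u + l v"
    and "\<And>c v. v \<in> T p \<Longrightarrow> l (c *\<^sub>R v) = c * l v"
    and "\<And>i. i \<in> I \<Longrightarrow> e i \<in> T p"
  shows "l (\<Sum>i\<in>I. c i *\<^sub>R e i) = (\<Sum>i\<in>I. c i * l (e i))"
proof -
  have "l 0 = 0" using assms(2)[OF T_zero, of 0] by simp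
  then show ?thesis
    using assms(3)
    by (induction I rule: infinite_finite_induct) (simp_all add: assms(1,2) T_scaleR T_vsum)
qed

lemma VF_zero: "0 \<in> VF"
  by (rule VF_I) (simp_all add: T_zero R_const)

lemma VF_plus: "X \<in> VF \<Longrightarrow> Y \<in> VF \<Longrightarrow> X + Y \<in> VF"
  by (rule VF_I) (simp_all add: T_plus VF_D R_add)

lemma VF_smul: "f \<in> R \<Longrightarrow> X \<in> VF \<Longrightarrow> smul f X \<in> VF"
  by (rule VF_I) (simp_all add: T_scaleR VF_D R_mult)

lemma VF_scaleR: "X \<in> VF \<Longrightarrow> c *\<^sub>R X \<in> VF"
  by (rule VF_I) (simp_all add: T_scaleR VF_D R_mult R_const)

lemma VF_minus: "X \<in> VF \<Longrightarrow> Y \<in> VF \<Longrightarrow> X - Y \<in> VF"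
  using VF_plus[OF _ VF_scaleR[of Y "- 1"]] by simp

lemma VF_vsum: "(\<And>i. i \<in> I \<Longrightarrow> X i \<in> VF) \<Longrightarrow> (\<Sum>i\<in>I. X i) \<in> VF"
  by (induction I rule: infinite_finite_induct) (simp_all add: VF_zero VF_plus)

text \<open>The frame fields are already global, so their combination with constant coefficients is
  an extension.\<close>

lemma VF_extend:
  assumes v: "v \<in> T p"
  obtains X where "X \<in> VF" "X p = v"
proof -
  obtain W and I :: "'e set" and E x where f: "p \<in> W" "\<And>i. i \<in> I \<Longrightarrow> E i \<in> VF"
    "\<And>q v f. q \<in> W \<Longrightarrow> v \<in> T q \<Longrightarrow> v f = (\<Sum>i\<in>I. v (x i) * E i q f)"
    by (rule frame[of p]) blast
  have "(\<Sum>i\<in>I. v (x i) *\<^sub>R E i) \<in> VF" by (intro VF_vsum VF_scaleR f(2))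
  moreover have "(\<Sum>i\<in>I. v (x i) *\<^sub>R E i) p = v"
  proof
    show "(\<Sum>i\<in>I. v (x i) *\<^sub>R E i) p g = v g" for g
      unfolding f(3)[OF f(1) v, of g] by (simp add: sum_fun_apply)
  qed
  ultimately show thesis by (rule that)
qed

lemma VF_lie_bracket:
  assumes X: "X \<in> VF" and Y: "Y \<in> VF"
  shows "lie_bracket X Y \<in> VF"
proof (rule VF_I)
  note XR = VF_D(2)[OF X] and YR = VF_D(2)[OF Y] and XT = VF_D(1)[OF X] and YT = VF_D(1)[OF Y]
  show "lie_bracket X Y p \<in> T p" for p
    unfolding T_iff lie_bracket_def
    by (simp add: T_add[OF XT] T_add[OF YT] T_scale[OF XT] T_scale[OF YT] T_mult[OF XT] T_mult[OF YT]
        T_out[OF XT] T_out[OF YT] T_const[OF XT] T_const[OF YT] XR YR R_mult algebra_simps)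
  show "(\<lambda>p. lie_bracket X Y p f) \<in> R" if "f \<in> R" for f
    unfolding lie_bracket_def by (intro R_diff XR YR that)
qed

text \<open>Cut off with a bump function and expand in a local frame.\<close>

lemma tensorial:
  fixes L :: "('a \<Rightarrow> 'a tvec) \<Rightarrow> 'a \<Rightarrow> real"
  assumes add: "\<And>X Y p. X \<in> VF \<Longrightarrow> Y \<in> VF \<Longrightarrow> L (X + Y) p = L X p + L Y p"
    and mult: "\<And>f X p. f \<in> R \<Longrightarrow> X \<in> VF \<Longrightarrow> L (smul f X) p = f p * L X p"
    and X: "X \<in> VF" and Y: "Y \<in> VF" and eq: "X p = Y p"
  shows "L X p = L Y p"
proof -
  have L0: "L 0 p = 0" using add[OF VF_zero VF_zero, of p] by simp
  have Lsum: "L (\<Sum>i\<in>I. Z i) p = (\<Sum>i\<in>I. L (Z i) p)" if "\<And>i. i \<in> I \<Longrightarrow> Z i \<in> VF" for I :: "'e set" and Z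
    using that by (induction I rule: infinite_finite_induct) (simp_all add: L0 add VF_vsum)
  \<comment> \<open>The difference X - Y, phrased with \<open>smul\<close> so that the two
    hypotheses on \<open>L\<close> apply to it directly.\<close>
  define Z where "Z = X + smul (\<lambda>q. - 1) Y"
  have Z: "Z \<in> VF" unfolding Z_def by (intro VF_plus VF_smul X Y R_const)
  have Zp: "Z p = 0" using eq by (simp add: Z_def)
  obtain W and I :: "'e set" and E x where f: "open W" "p \<in> W" "\<And>i. i \<in> I \<Longrightarrow> E i \<in> VF"
    "\<And>i. i \<in> I \<Longrightarrow> x i \<in> R"
    "\<And>q v f. q \<in> W \<Longrightarrow> v \<in> T q \<Longrightarrow> v f = (\<Sum>i\<in>I. v (x i) * E i q f)"
    by (rule frame[of p]) blast
  obtain \<rho> where \<rho>: "\<rho> \<in> R" "\<rho> p = 1" "\<And>q. q \<notin> W \<Longrightarrow> \<rho> q = 0" by (rule R_bump[OF f(1,2)]) blast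
  let ?a = "\<lambda>i q. \<rho> q * Z q (x i)"
  have aR: "?a i \<in> R" if "i \<in> I" for i by (intro R_mult \<rho>(1) VF_D(2)[OF Z] f(4) that)
  \<comment> \<open>An identity on all of M: on W it is the frame expansion, and off W both sides
    vanish with \<rho>. The coefficients are global and vanish at p because Z does.\<close>
  have "smul \<rho> Z = (\<Sum>i\<in>I. smul (?a i) (E i))"
  proof (intro ext)
    fix q g
    show "smul \<rho> Z q g = (\<Sum>i\<in>I. smul (?a i) (E i)) q g"
      using f(5)[OF _ VF_D(1)[OF Z], of q g] \<rho>(3)[of q]
      by (cases "q \<in> W") (simp_all add: sum_fun_apply sum_distrib_left mult.assoc)
  qed
  then have "L Z p = (\<Sum>i\<in>I. ?a i p * L (E i) p)"
    using mult[OF \<rho>(1) Z, of p] \<rho>(2) Lsum[of I "\<lambda>i. smul (?a i) (E i)"]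
    by (simp add: VF_smul aR f(3) mult)
  then have "L Z p = 0" by (simp add: Zp)
  then show ?thesis
    unfolding Z_def using add[OF X VF_smul[OF R_const Y]] mult[OF R_const Y] by simp
qed

text \<open>The covector at p evaluates \<open>L\<close> on an arbitrary field through the given
  vector; \<open>tensorial\<close> makes the choice irrelevant, and linearity follows by adding or
  scaling extensions.\<close>

lemma one_form_of_tensor:
  fixes L :: "('a \<Rightarrow> 'a tvec) \<Rightarrow> 'a \<Rightarrow> real"
  assumes add: "\<And>X Y p. X \<in> VF \<Longrightarrow> Y \<in> VF \<Longrightarrow> L (X + Y) p = L X p + L Y p"
    and mult: "\<And>f X p. f \<in> R \<Longrightarrow> X \<in> VF \<Longrightarrow> L (smul f X) p = f p * L X p"
    and R: "\<And>X. X \<in> VF \<Longrightarrow> L X \<in> R"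
  obtains \<gamma> where "\<gamma> \<in> one_forms A" "\<And>X p. X \<in> VF \<Longrightarrow> \<gamma> p (X p) = L X p"
proof
  define \<gamma> where "\<gamma> p v = (if v \<in> T p then L (SOME X. X \<in> VF \<and> X p = v) p else 0)" for p v
  have \<gamma>: "\<gamma> p (X p) = L X p" if "X \<in> VF" for X p
  proof -
    have "(SOME Y. Y \<in> VF \<and> Y p = X p) \<in> VF \<and> (SOME Y. Y \<in> VF \<and> Y p = X p) p = X p"
      by (rule someI[where x = X]) (use that in simp)
    then show ?thesis using tensorial[OF add mult _ that] VF_D(1)[OF that] by (simp add: \<gamma>_def)
  qed
  then show "\<And>X p. X \<in> VF \<Longrightarrow> \<gamma> p (X p) = L X p" .
  have "\<gamma> p (v + w) = \<gamma> p v + \<gamma> p w" if vw: "v \<in> T p" "w \<in> T p" for p v w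
  proof -
    obtain X where X: "X \<in> VF" "X p = v" by (rule VF_extend[OF vw(1)])
    obtain Y where Y: "Y \<in> VF" "Y p = w" by (rule VF_extend[OF vw(2)])
    show ?thesis using X Y \<gamma>[OF VF_plus, of X Y p] \<gamma>[of X p] \<gamma>[of Y p] add[of X Y p] by simp
  qed
  moreover have "\<gamma> p (c *\<^sub>R v) = c * \<gamma> p v" if "v \<in> T p" for p v c
  proof -
    obtain X where X: "X \<in> VF" "X p = v" by (rule VF_extend[OF \<open>v \<in> T p\<close>])
    then show ?thesis using \<gamma>[OF VF_smul[OF R_const[of c] X(1)], of p] \<gamma>[OF X(1), of p] mult[OF R_const[of c] X(1), of p]
      by simp
  qed
  ultimately have "\<gamma> p \<in> cotangent_space A p" for p
    unfolding cotangent_space_def by (simp add: \<gamma>_def)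
  then show "\<gamma> \<in> one_forms A" unfolding one_forms_def using \<gamma> R by simp
qed

section \<open>Smooth dependence of solutions of linear systems\<close>

text \<open>Germs are not formed as equivalence classes: this is a property of plain functions,
  whose behaviour away from p is left open. It suits coefficients whose smoothness is still to be
  proved.\<close>

definition germ :: "'a \<Rightarrow> ('a \<Rightarrow> real) \<Rightarrow> bool" where
  "germ p f \<longleftrightarrow> (\<exists>g\<in>R. \<forall>\<^sub>F q in nhds p. f q = g q)"

lemma germ_R: "f \<in> R \<Longrightarrow> germ p f"
  unfolding germ_def by (auto intro!: bexI[of _ f])

lemma germ_cong:
  assumes "germ p g" "\<forall>\<^sub>F q in nhds p. f q = g q"
  shows "germ p f"
proof -
  obtain g' where g': "g' \<in> R" "\<forall>\<^sub>F q in nhds p. g q = g' q" using assms(1) unfolding germ_def by blast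
  from assms(2) g'(2) have "\<forall>\<^sub>F q in nhds p. f q = g' q" by eventually_elim simp
  then show ?thesis unfolding germ_def using g'(1) by blast
qed

lemma germ_add:
  assumes "germ p f" "germ p g"
  shows "germ p (\<lambda>q. f q + g q)"
proof -
  obtain f' g' where R: "f' \<in> R" "g' \<in> R" and
    ev: "\<forall>\<^sub>F q in nhds p. f q = f' q" "\<forall>\<^sub>F q in nhds p. g q = g' q"
    using assms unfolding germ_def by blast
  from ev have "\<forall>\<^sub>F q in nhds p. f q + g q = f' q + g' q" by eventually_elim simp
  then show ?thesis unfolding germ_def by (rule bexI[OF _ R_add[OF R]])
qed

lemma germ_mult:
  assumes "germ p f" "germ p g"
  shows "germ p (\<lambda>q. f q * g q)"
proof -
  obtain f' g' where R: "f' \<in> R" "g' \<in> R" and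
    ev: "\<forall>\<^sub>F q in nhds p. f q = f' q" "\<forall>\<^sub>F q in nhds p. g q = g' q"
    using assms unfolding germ_def by blast
  from ev have "\<forall>\<^sub>F q in nhds p. f q * g q = f' q * g' q" by eventually_elim simp
  then show ?thesis unfolding germ_def by (rule bexI[OF _ R_mult[OF R]])
qed

lemma germ_diff: "germ p f \<Longrightarrow> germ p g \<Longrightarrow> germ p (\<lambda>q. f q - g q)"
  using germ_add[of p f "\<lambda>q. - 1 * g q"] germ_mult[OF germ_R[OF R_const[of "- 1"]], of p g] by simp

lemma germ_sum: "(\<And>i. i \<in> I \<Longrightarrow> germ p (f i)) \<Longrightarrow> germ p (\<lambda>q. \<Sum>i\<in>I. f i q)"
  by (induction I rule: infinite_finite_induct) (simp_all add: germ_R R_const germ_add)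

lemma germ_inverse:
  assumes "germ p f" "f p \<noteq> 0"
  obtains k where "germ p k" "\<forall>\<^sub>F q in nhds p. k q * f q = 1"
proof -
  obtain g where g: "g \<in> R" "\<forall>\<^sub>F q in nhds p. f q = g q" using assms(1) unfolding germ_def by blast
  then have "g p \<noteq> 0" using assms(2) eventually_nhds_x_imp_x[OF g(2)] by simp
  obtain k where k: "k \<in> R" "\<forall>\<^sub>F q in nhds p. k q * g q = 1" by (rule R_inverse[OF g(1) \<open>g p \<noteq> 0\<close>])
  from k(2) g(2) have "\<forall>\<^sub>F q in nhds p. k q * f q = 1" by eventually_elim simp
  then show thesis by (rule that[OF germ_R[OF k(1)]])
qed

text \<open>Gaussian elimination over the ring of germs.\<close>

lemma germ_linear_system:
  assumes "finite I" "\<And>i j. i \<in> I \<Longrightarrow> j \<in> J \<Longrightarrow> germ p (H i j)" "\<And>j. j \<in> J \<Longrightarrow> germ p (b j)"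
    and "\<And>j. j \<in> J \<Longrightarrow> \<forall>\<^sub>F q in nhds p. (\<Sum>i\<in>I. c i q * H i j q) = b j q"
    and "\<And>a i. (\<And>j. j \<in> J \<Longrightarrow> (\<Sum>i\<in>I. a i * H i j p) = 0) \<Longrightarrow> i \<in> I \<Longrightarrow> a i = 0"
    and "i \<in> I"
  shows "germ p (c i)"
  using assms
proof (induction I arbitrary: H b i rule: finite_induct)
  case empty
  then show ?case by simp
next
  case (insert i0 I)
  note H = insert.prems(1) and b = insert.prems(2) and eq = insert.prems(3) and inj = insert.prems(4)
  \<comment> \<open>A pivot exists: otherwise the unit vector at i0 would contradict injectivity at
    p. Being non-zero at p, the pivot is invertible as a germ.\<close>
  have "\<exists>j0\<in>J. H i0 j0 p \<noteq> 0"
  proof (rule ccontr)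
    assume "\<not> ?thesis"
    then have "(\<Sum>i\<in>insert i0 I. (if i = i0 then 1 else 0) * H i j p) = 0" if "j \<in> J" for j
      using that insert.hyps by (auto intro!: sum.neutral)
    from inj[OF this, of i0] show False by simp
  qed
  then obtain j0 where j0: "j0 \<in> J" "H i0 j0 p \<noteq> 0" by blast
  obtain k where k: "germ p k" "\<forall>\<^sub>F q in nhds p. k q * H i0 j0 q = 1"
    by (rule germ_inverse[OF H[OF insertI1 j0(1)] j0(2)])
  have kp: "k p * H i0 j0 p = 1" by (rule eventually_nhds_x_imp_x[OF k(2)])
  \<comment> \<open>From equation j, subtract k H i0 j times equation j0. Near p this removes the
    unknown c i0 and leaves the other unknowns as they are.\<close>
  define H' where "H' i j q = H i j q - H i j0 q * (k q * H i0 j q)" for i j q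
  define b' where "b' j q = b j q - b j0 q * (k q * H i0 j q)" for j q
  have I: "germ p (c i)" if "i \<in> I" for i
  proof (rule insert.IH[where H = H' and b = b'])
    show "germ p (H' i j)" if "i \<in> I" "j \<in> J" for i j
      unfolding H'_def by (intro germ_diff germ_mult H k(1) j0 that insertI2[OF that(1)] insertI1)
    show "germ p (b' j)" if "j \<in> J" for j
      unfolding b'_def by (intro germ_diff germ_mult H b k(1) j0 that insertI1)
    show "\<forall>\<^sub>F q in nhds p. (\<Sum>i\<in>I. c i q * H' i j q) = b' j q" if "j \<in> J" for j
      using eq[OF that] eq[OF j0(1)] k(2)
    proof eventually_elim
      case (elim q)
      let ?S = "\<lambda>j. \<Sum>i\<in>I. c i q * H i j q"
      have "(\<Sum>i\<in>I. c i q * H' i j q) = ?S j - ?S j0 * (k q * H i0 j q)"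
        by (simp add: H'_def right_diff_distrib sum_subtractf sum_distrib_right mult.assoc)
      moreover have "?S j = b j q - c i0 q * H i0 j q" "?S j0 = b j0 q - c i0 q * H i0 j0 q"
        using elim(1,2) insert.hyps by simp_all
      ultimately have "(\<Sum>i\<in>I. c i q * H' i j q) =
          b j q - c i0 q * H i0 j q - b j0 q * (k q * H i0 j q) + c i0 q * H i0 j q * (k q * H i0 j0 q)"
        by (simp add: algebra_simps)
      then show ?case using elim(3) by (simp add: b'_def)
    qed
    show "a i = 0" if a: "\<And>j. j \<in> J \<Longrightarrow> (\<Sum>i\<in>I. a i * H' i j p) = 0" and i: "i \<in> I" for a i
    proof -
      \<comment> \<open>The coefficient at i0 that extends a kernel vector of the reduced system at
        p to one of the full system; injectivity is inherited this way.\<close>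
      define a0 where "a0 = - (\<Sum>i\<in>I. a i * H i j0 p) * k p"
      define a' where "a' i = (if i = i0 then a0 else a i)" for i
      have a'I: "(\<Sum>i\<in>I. a' i * H i j p) = (\<Sum>i\<in>I. a i * H i j p)" for j
        by (rule sum.cong) (use insert.hyps in \<open>auto simp: a'_def\<close>)
      have "(\<Sum>i\<in>insert i0 I. a' i * H i j p) = 0" if "j \<in> J" for j
      proof -
        have "(\<Sum>i\<in>I. a i * H' i j p) = (\<Sum>i\<in>I. a i * H i j p) + a0 * H i0 j p"
          by (simp add: H'_def a0_def right_diff_distrib sum_subtractf sum_distrib_right mult.assoc)
        then show ?thesis using a[OF that] insert.hyps a'I by (simp add: a'_def)
      qed
      from inj[OF this, of i] show ?thesis using i insert.hyps by (auto simp: a'_def split: if_splits)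
    qed
  qed (use that in simp)
  show ?case
  proof (cases "i = i0")
    case True
    \<comment> \<open>Back-substitution: equation j0 is solved for c i0.\<close>
    have "germ p (\<lambda>q. (b j0 q - (\<Sum>i\<in>I. c i q * H i j0 q)) * k q)"
      by (intro germ_mult germ_diff germ_sum b H I k(1) j0(1) insertI2)
    moreover have "\<forall>\<^sub>F q in nhds p. c i0 q = (b j0 q - (\<Sum>i\<in>I. c i q * H i j0 q)) * k q"
      using eq[OF j0(1)] k(2)
    proof eventually_elim
      case (elim q)
      have "b j0 q - (\<Sum>i\<in>I. c i q * H i j0 q) = c i0 q * H i0 j0 q"
        using elim(1) insert.hyps by simp
      then show ?case using elim(2) by (simp add: mult.assoc mult.commute[of "H i0 j0 q"])
    qed
    ultimately show ?thesis unfolding True by (rule germ_cong)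
  qed (use I insert.prems(5) in blast)
qed

end

section \<open>Forms and connections\<close>

locale form_connection = smooth_manifold A
  for A :: "('a::{t2_space,second_countable_topology}, 'e::euclidean_space) atlas" +
  fixes h :: "'a \<Rightarrow> 'a tvec \<Rightarrow> 'a tvec \<Rightarrow> real"
    and nabla :: "('a \<Rightarrow> 'a tvec) \<Rightarrow> ('a \<Rightarrow> 'a tvec) \<Rightarrow> 'a \<Rightarrow> 'a tvec"
  assumes bilinear: "bilinear_form A (tangent_space A) (vector_fields A) h"
    and nondeg: "nondegenerate (tangent_space A) h"
    and sym: "symmetric_form (tangent_space A) h \<or> skew_form (tangent_space A) h"
    and connection: "affine_connection A (vector_fields A) id nabla"
begin

abbreviation Om where "Om \<equiv> one_forms A"

lemma
  assumes "u \<in> T p" "v \<in> T p"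
  shows h_add: "w \<in> T p \<Longrightarrow> h p (u + v) w = h p u w + h p v w" "w \<in> T p \<Longrightarrow> h p w (u + v) = h p w u + h p w v"
    and h_scaleR: "h p (c *\<^sub>R u) v = c * h p u v" "h p u (c *\<^sub>R v) = c * h p u v"
  using bilinear assms unfolding bilinear_form_def by blast+

lemma h_smooth: "X \<in> VF \<Longrightarrow> Y \<in> VF \<Longrightarrow> (\<lambda>q. h q (X q) (Y q)) \<in> R"
  using bilinear unfolding bilinear_form_def app_def by blast

lemma h_minus: "u \<in> T p \<Longrightarrow> v \<in> T p \<Longrightarrow> w \<in> T p \<Longrightarrow> h p (u - v) w = h p u w - h p v w"
  using h_add(1)[of u p "- 1 *\<^sub>R v" w] h_scaleR(1)[of v p w "- 1"] T_scaleR[of v p "- 1"] by simp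

lemma h_nondeg: "u \<in> T p \<Longrightarrow> (\<And>v. v \<in> T p \<Longrightarrow> h p u v = 0) \<Longrightarrow> u = 0"
  using nondeg unfolding nondegenerate_def by blast

definition form_sign :: real where "form_sign = (if symmetric_form (tangent_space A) h then 1 else - 1)"

lemma h_swap: "u \<in> T p \<Longrightarrow> v \<in> T p \<Longrightarrow> h p u v = form_sign * h p v u"
  using sym unfolding form_sign_def symmetric_form_def skew_form_def by (cases "symmetric_form T h") (auto simp: symmetric_form_def)

lemma hat_form_eq: "hat_form A h p (u, \<alpha>) (w, \<beta>) = - (1 / 2) * (\<alpha> w + form_sign * \<beta> u)"
  by (simp add: hat_form_def form_sign_def)

section \<open>Covectors and the inverse of h\<close>

lemma
  assumes "\<alpha> \<in> cotangent_space A p" "u \<in> T p"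
  shows cov_add: "v \<in> T p \<Longrightarrow> \<alpha> (u + v) = \<alpha> u + \<alpha> v"
    and cov_scaleR: "\<alpha> (c *\<^sub>R u) = c * \<alpha> u"
  using assms unfolding cotangent_space_def by auto

lemma cov_out: "\<alpha> \<in> cotangent_space A p \<Longrightarrow> u \<notin> T p \<Longrightarrow> \<alpha> u = 0"
  unfolding cotangent_space_def by auto

lemma Om_D: "\<beta> \<in> Om \<Longrightarrow> \<beta> p \<in> cotangent_space A p" "\<beta> \<in> Om \<Longrightarrow> X \<in> VF \<Longrightarrow> (\<lambda>q. \<beta> q (X q)) \<in> R"
  unfolding one_forms_def by auto

text \<open>The fibre is only a subset of a function space, so the dimension argument is moved to
  the model space: F sends the frame coordinates \<xi> of a vector to its h-products with the frame.
  Non-degeneracy makes this endomorphism injective, hence surjective.\<close>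

lemma riesz:
  assumes \<alpha>: "\<alpha> \<in> cotangent_space A p"
  shows "\<exists>v\<in>T p. \<forall>w\<in>T p. h p v w = \<alpha> w"
proof -
  obtain W and I :: "'e set" and E x where f: "p \<in> W" "I = Basis \<or> I = {}" "\<And>i. i \<in> I \<Longrightarrow> E i \<in> VF"
    "\<And>q v f. q \<in> W \<Longrightarrow> v \<in> T q \<Longrightarrow> v f = (\<Sum>i\<in>I. v (x i) * E i q f)"
    "\<And>q i j. q \<in> W \<Longrightarrow> i \<in> I \<Longrightarrow> j \<in> I \<Longrightarrow> E i q (x j) = (if i = j then 1 else 0)"
    by (rule frame[of p]) blast
  have expand: "w = (\<Sum>i\<in>I. w (x i) *\<^sub>R E i p)" if "w \<in> T p" for w
  proof
    show "w g = (\<Sum>i\<in>I. w (x i) *\<^sub>R E i p) g" for g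
      using f(4)[OF f(1) that, of g] by (simp add: sum_fun_apply)
  qed
  have ET: "E i p \<in> T p" if "i \<in> I" for i using VF_D(1)[OF f(3)[OF that]] .
  have frame_eqI: "l w = l' w"
    if "\<And>u v. u \<in> T p \<Longrightarrow> v \<in> T p \<Longrightarrow> l (u + v) = l u + l v" "\<And>c v. v \<in> T p \<Longrightarrow> l (c *\<^sub>R v) = c * l v"
      "\<And>u v. u \<in> T p \<Longrightarrow> v \<in> T p \<Longrightarrow> l' (u + v) = l' u + l' v" "\<And>c v. v \<in> T p \<Longrightarrow> l' (c *\<^sub>R v) = c * l' v"
      "\<And>i. i \<in> I \<Longrightarrow> l (E i p) = l' (E i p)" "w \<in> T p" for l l' :: "'a tvec \<Rightarrow> real" and w
  proof -
    have "l (\<Sum>i\<in>I. w (x i) *\<^sub>R E i p) = l' (\<Sum>i\<in>I. w (x i) *\<^sub>R E i p)"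
      using T_linear_sum[of p l I "\<lambda>i. E i p" "\<lambda>i. w (x i)"]
        T_linear_sum[of p l' I "\<lambda>i. E i p" "\<lambda>i. w (x i)"] that(1-5) ET by simp
    then show ?thesis using expand[OF that(6)] by simp
  qed
  show ?thesis
  proof (cases "I = {}")
    case True
    have "h p 0 w = \<alpha> w" if "w \<in> T p" for w
      by (rule frame_eqI[of "h p 0" \<alpha>, OF _ _ _ _ _ that]) (simp_all add: True h_add h_scaleR T_zero cov_add[OF \<alpha>] cov_scaleR[OF \<alpha>])
    then show ?thesis using T_zero by blast
  next
    case False
    then have I: "I = Basis" using f(2) by blast
    define V where "V \<xi> = (\<Sum>i\<in>Basis. (\<xi> \<bullet> i) *\<^sub>R E i p)" for \<xi> :: 'e
    have VT: "V \<xi> \<in> T p" for \<xi> unfolding V_def by (intro T_vsum T_scaleR ET) (simp add: I)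
    have V_add: "V (\<xi> + \<eta>) = V \<xi> + V \<eta>" for \<xi> \<eta>
      by (simp add: V_def inner_add_left scaleR_add_left sum.distrib)
    have V_scaleR: "V (c *\<^sub>R \<xi>) = c *\<^sub>R V \<xi>" for c \<xi> by (simp add: V_def scaleR_sum_right)
    define F where "F \<xi> = (\<Sum>j\<in>Basis. h p (V \<xi>) (E j p) *\<^sub>R j)" for \<xi> :: 'e
    have F: "F \<xi> \<bullet> j = h p (V \<xi>) (E j p)" if "j \<in> Basis" for j \<xi>
      unfolding F_def using that by (simp add: inner_sum_left_Basis)
    have lin: "linear F"
      by (rule linearI)
        (simp_all add: F_def V_add V_scaleR h_add h_scaleR VT ET I scaleR_add_left sum.distrib scaleR_sum_right)
    have "inj F"
      unfolding linear_injective_0[OF lin]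
    proof (intro allI impI)
      fix \<xi> assume "F \<xi> = 0"
      then have "h p (V \<xi>) (E j p) = 0" if "j \<in> Basis" for j using F[OF that, of \<xi>] by simp
      then have "h p (V \<xi>) w = 0" if "w \<in> T p" for w
        by (intro frame_eqI[of "h p (V \<xi>)" "\<lambda>w. 0", OF _ _ _ _ _ that]) (simp_all add: h_add h_scaleR VT I)
      then have "V \<xi> = 0" by (rule h_nondeg[OF VT])
      then have "V \<xi> (x j) = 0" for j by simp
      moreover have "V \<xi> (x j) = \<xi> \<bullet> j" if "j \<in> Basis" for j
      proof -
        have "V \<xi> (x j) = (\<Sum>i\<in>Basis. (\<xi> \<bullet> i) * (if i = j then 1 else 0))"
          unfolding V_def sum_fun_apply by (rule sum.cong) (use f(5)[OF f(1)] that I in auto)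
        then show ?thesis using that by (simp add: if_distrib cong: if_cong)
      qed
      ultimately show "\<xi> = 0" by (metis euclidean_all_zero_iff)
    qed
    then have "surj F" by (rule linear_inj_imp_surj[OF lin])
    then obtain \<xi> where \<xi>: "F \<xi> = (\<Sum>j\<in>Basis. \<alpha> (E j p) *\<^sub>R j)" by (metis surjD)
    have "h p (V \<xi>) (E j p) = \<alpha> (E j p)" if "j \<in> Basis" for j
      using F[OF that, of \<xi>] that by (simp add: \<xi> inner_sum_left_Basis)
    then have "h p (V \<xi>) w = \<alpha> w" if "w \<in> T p" for w
      by (intro frame_eqI[of "h p (V \<xi>)" \<alpha>, OF _ _ _ _ _ that])
        (simp_all add: h_add h_scaleR VT I cov_add[OF \<alpha>] cov_scaleR[OF \<alpha>])
    then show ?thesis using VT by blast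
  qed
qed

lemma sharp_eqI:
  assumes "\<And>p. V p \<in> T p" "\<And>p w. w \<in> T p \<Longrightarrow> h p (V p) w = \<beta> p w"
  shows "sharp A h \<beta> = V"
  unfolding sharp_def
proof (rule ext, rule the_equality)
  fix p v assume v: "v \<in> T p \<and> (\<forall>w\<in>T p. h p v w = \<beta> p w)"
  have "v - V p = 0"
    by (rule h_nondeg[where p = p]) (use v assms in \<open>simp_all add: T_minus h_minus\<close>)
  then show "v = V p" by simp
qed (use assms in blast)

lemma
  assumes "\<beta> \<in> Om"
  shows sharp_T: "sharp A h \<beta> p \<in> T p" and h_sharp: "w \<in> T p \<Longrightarrow> h p (sharp A h \<beta> p) w = \<beta> p w"
proof -
  obtain V where V: "\<And>p. V p \<in> T p \<and> (\<forall>w\<in>T p. h p (V p) w = \<beta> p w)"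
    using riesz[OF Om_D(1)[OF assms]] by metis
  then have "sharp A h \<beta> = V" by (intro sharp_eqI) auto
  then show "sharp A h \<beta> p \<in> T p" "w \<in> T p \<Longrightarrow> h p (sharp A h \<beta> p) w = \<beta> p w" using V by auto
qed

text \<open>The frame components of h^-1(\<beta>) solve a linear system with smooth coefficients h(E
  i, E j) and smooth right-hand side \<beta>(E j); \<open>germ_linear_system\<close> makes them
  smooth near each point.\<close>

lemma sharp_VF:
  assumes \<beta>: "\<beta> \<in> Om"
  shows "sharp A h \<beta> \<in> VF"
proof (rule VF_I[OF sharp_T[OF \<beta>]])
  let ?V = "sharp A h \<beta>"
  fix g assume g: "g \<in> R"
  show "(\<lambda>p. ?V p g) \<in> R"
  proof (rule R_local)
    fix p :: 'a
    obtain W and I :: "'e set" and E x where f: "open W" "p \<in> W" "I = Basis \<or> I = {}" "\<And>i. i \<in> I \<Longrightarrow> E i \<in> VF"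
      "\<And>q v f. q \<in> W \<Longrightarrow> v \<in> T q \<Longrightarrow> v f = (\<Sum>i\<in>I. v (x i) * E i q f)"
      "\<And>q i j. q \<in> W \<Longrightarrow> i \<in> I \<Longrightarrow> j \<in> I \<Longrightarrow> E i q (x j) = (if i = j then 1 else 0)"
      by (rule frame[of p]) blast
    have ET: "E i q \<in> T q" if "i \<in> I" for i q using VF_D(1)[OF f(4)[OF that]] .
    have W: "\<forall>\<^sub>F q in nhds p. q \<in> W" by (rule eventually_nhds_in_open[OF f(1,2)])
    have expand: "w = (\<Sum>i\<in>I. w (x i) *\<^sub>R E i q)" if "w \<in> T q" "q \<in> W" for w q
    proof
      show "w g = (\<Sum>i\<in>I. w (x i) *\<^sub>R E i q) g" for g
        using f(5)[OF that(2,1), of g] by (simp add: sum_fun_apply)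
    qed
    have hsum: "h q (\<Sum>i\<in>I. c i *\<^sub>R E i q) w = (\<Sum>i\<in>I. c i * h q (E i q) w)" if "w \<in> T q" for q c w
      by (rule T_linear_sum[of q "\<lambda>u. h q u w"]) (simp_all add: h_add h_scaleR ET that)
    have c: "germ p (\<lambda>q. ?V q (x i))" if "i \<in> I" for i
    proof (rule germ_linear_system[where H = "\<lambda>i j q. h q (E i q) (E j q)" and b = "\<lambda>j q. \<beta> q (E j q)", OF _ _ _ _ _ that])
      show "finite I" using f(3) by auto
      show "germ p (\<lambda>q. h q (E i q) (E j q))" if "i \<in> I" "j \<in> I" for i j
        by (intro germ_R h_smooth f(4) that)
      show "germ p (\<lambda>q. \<beta> q (E j q))" if "j \<in> I" for j
        by (intro germ_R Om_D(2)[OF \<beta>] f(4) that)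
      show "\<forall>\<^sub>F q in nhds p. (\<Sum>i\<in>I. ?V q (x i) * h q (E i q) (E j q)) = \<beta> q (E j q)" if "j \<in> I" for j
        using W
      proof eventually_elim
        case (elim q)
        show ?case
          using hsum[OF ET[OF that], of q "\<lambda>i. ?V q (x i)"] expand[OF sharp_T[OF \<beta>] elim] h_sharp[OF \<beta> ET[OF that]]
          by simp
      qed
      \<comment> \<open>A kernel vector yields a tangent vector at p that is h-orthogonal to the
        frame, hence zero; its coordinates, read off by the \<open>x i\<close>, are the a i.\<close>
      show "a i = 0" if a: "\<And>j. j \<in> I \<Longrightarrow> (\<Sum>i\<in>I. a i * h p (E i p) (E j p)) = 0" and i: "i \<in> I" for a i
      proof -
        let ?u = "\<Sum>i\<in>I. a i *\<^sub>R E i p"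
        have uT: "?u \<in> T p" by (intro T_vsum T_scaleR ET)
        have "h p ?u w = 0" if w: "w \<in> T p" for w
        proof -
          have "h p ?u (\<Sum>j\<in>I. w (x j) *\<^sub>R E j p) = (\<Sum>j\<in>I. w (x j) * h p ?u (E j p))"
            by (rule T_linear_sum[of p "h p ?u"]) (simp_all add: h_add h_scaleR ET uT)
          then show ?thesis using expand[OF w f(2)] hsum[OF ET, of _ p a] a by simp
        qed
        then have "?u = 0" by (rule h_nondeg[OF uT])
        then have "0 = ?u (x i)" by simp
        also have "\<dots> = (\<Sum>j\<in>I. a j * (if j = i then 1 else 0))"
          unfolding sum_fun_apply by (rule sum.cong) (use f(6)[OF f(2)] i in auto)
        also have "\<dots> = a i" using i f(3) by (auto simp: if_distrib cong: if_cong)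
        finally show ?thesis by simp
      qed
    qed
    have "germ p (\<lambda>q. \<Sum>i\<in>I. ?V q (x i) * E i q g)"
      by (intro germ_sum germ_mult c germ_R VF_D(2)[OF f(4)] g)
    moreover have "\<forall>\<^sub>F q in nhds p. ?V q g = (\<Sum>i\<in>I. ?V q (x i) * E i q g)"
      using W by eventually_elim (rule f(5)[OF _ sharp_T[OF \<beta>]])
    ultimately have "germ p (\<lambda>q. ?V q g)" by (rule germ_cong)
    then show "\<exists>k\<in>R. \<forall>\<^sub>F q in nhds p. ?V q g = k q" unfolding germ_def .
  qed
qed

section \<open>The connection and its extension to 1-forms\<close>

lemma
  assumes "X \<in> VF" "Y \<in> VF"
  shows nabla_VF: "nabla X Y \<in> VF"
    and nabla_add: "Z \<in> VF \<Longrightarrow> nabla (X + Y) Z = nabla X Z + nabla Y Z"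
      "Z \<in> VF \<Longrightarrow> nabla Z (X + Y) = nabla Z X + nabla Z Y"
    and nabla_scaleR: "nabla (c *\<^sub>R X) Y = c *\<^sub>R nabla X Y" "nabla X (c *\<^sub>R Y) = c *\<^sub>R nabla X Y"
    and nabla_smul: "f \<in> R \<Longrightarrow> nabla (smul f X) Y = smul f (nabla X Y)"
      "f \<in> R \<Longrightarrow> nabla X (smul f Y) = smul (act id X f) Y + smul f (nabla X Y)"
  using connection assms unfolding affine_connection_def by blast+

lemma cov_form:
  assumes X: "X \<in> VF" and \<beta>: "\<beta> \<in> Om"
  shows "cov_form A nabla X \<beta> \<in> Om"
    and "Y \<in> VF \<Longrightarrow> cov_form A nabla X \<beta> p (Y p) = X p (\<lambda>q. \<beta> q (Y q)) - \<beta> p (nabla X Y p)"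
proof -
  let ?L = "\<lambda>Y p. X p (\<lambda>q. \<beta> q (Y q)) - \<beta> p (nabla X Y p)"
  note XT = VF_D(1)[OF X] and \<beta>R = Om_D(2)[OF \<beta>] and nT = VF_D(1)[OF nabla_VF[OF X]] and
    \<beta>_add = cov_add[OF Om_D(1)[OF \<beta>]] and \<beta>_scaleR = cov_scaleR[OF Om_D(1)[OF \<beta>]]
  obtain \<gamma> where \<gamma>: "\<gamma> \<in> Om" "\<And>Y p. Y \<in> VF \<Longrightarrow> \<gamma> p (Y p) = ?L Y p"
  proof (rule one_form_of_tensor[of ?L])
    show "?L (Y + Z) p = ?L Y p + ?L Z p" if "Y \<in> VF" "Z \<in> VF" for Y Z p
      by (simp add: nabla_add that X nT \<beta>_add VF_D(1) T_add[OF XT] \<beta>R)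
    \<comment> \<open>The term X(f) \<beta>(Y) arises both from X(f \<beta>(Y)) and from \<beta>
      applied to the Leibniz rule for f Y, and cancels.\<close>
    show "?L (smul f Y) p = f p * ?L Y p" if "f \<in> R" "Y \<in> VF" for f Y p
      by (simp add: nabla_smul that X nT \<beta>_add \<beta>_scaleR VF_D(1) T_scaleR T_mult[OF XT] \<beta>R act_def
          algebra_simps)
    show "?L Y \<in> R" if "Y \<in> VF" for Y
      by (intro R_diff VF_D(2)[OF X] \<beta>R that nabla_VF X)
  qed (rule that; assumption)
  have "cov_form A nabla X \<beta> = \<gamma>"
    unfolding cov_form_def
  proof (rule the_equality)
    show "\<gamma> \<in> Om \<and> (\<forall>Y\<in>VF. \<forall>p. \<gamma> p (Y p) = ?L Y p)" using \<gamma> by blast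
    fix \<delta> assume \<delta>: "\<delta> \<in> Om \<and> (\<forall>Y\<in>VF. \<forall>p. \<delta> p (Y p) = ?L Y p)"
    \<comment> \<open>Agreement on fields is agreement on vectors, since every tangent vector
      extends to a field; outside the tangent space both sides are 0 by convention.\<close>
    show "\<delta> = \<gamma>"
    proof (intro ext)
      fix p v
      show "\<delta> p v = \<gamma> p v"
      proof (cases "v \<in> T p")
        case True
        obtain Y where "Y \<in> VF" "Y p = v" by (rule VF_extend[OF True])
        then show ?thesis using \<delta> \<gamma>(2) by metis
      next
        case False
        then show ?thesis using cov_out Om_D(1) \<delta> \<gamma>(1) by metis
      qed
    qed
  qed
  then show "cov_form A nabla X \<beta> \<in> Om"
    and "Y \<in> VF \<Longrightarrow> cov_form A nabla X \<beta> p (Y p) = X p (\<lambda>q. \<beta> q (Y q)) - \<beta> p (nabla X Y p)"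
    using \<gamma> by auto
qed

section \<open>Lowering and raising as mutually inverse module maps\<close>

lemma flat_Om: "X \<in> VF \<Longrightarrow> flat A h X \<in> Om"
  unfolding one_forms_def cotangent_space_def flat_def
  by (simp add: h_add h_scaleR VF_D(1) T_plus T_scaleR h_smooth)

lemma sharp_flat: "X \<in> VF \<Longrightarrow> sharp A h (flat A h X) = X"
  by (rule sharp_eqI) (simp_all add: VF_D(1) flat_def)

lemma flat_sharp: "\<beta> \<in> Om \<Longrightarrow> flat A h (sharp A h \<beta>) = \<beta>"
  unfolding flat_def by (intro ext) (simp add: h_sharp cov_out[OF Om_D(1)])

lemma flat_add: "X \<in> VF \<Longrightarrow> Y \<in> VF \<Longrightarrow> flat A h (X + Y) = flat A h X + flat A h Y"
  by (intro ext) (simp add: flat_def h_add VF_D(1))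

lemma flat_smul: "X \<in> VF \<Longrightarrow> flat A h (smul f X) = smul f (flat A h X)"
  by (intro ext) (simp add: flat_def h_scaleR VF_D(1))

lemma sharp_add: "\<alpha> \<in> Om \<Longrightarrow> \<beta> \<in> Om \<Longrightarrow> sharp A h (\<alpha> + \<beta>) = sharp A h \<alpha> + sharp A h \<beta>"
  by (rule sharp_eqI) (simp_all add: sharp_T T_plus h_add h_sharp)

lemma flat_scaleR: "X \<in> VF \<Longrightarrow> flat A h (c *\<^sub>R X) = c *\<^sub>R flat A h X"
  by (intro ext) (simp add: flat_def h_scaleR VF_D(1))

lemma sharp_scaleR: "\<beta> \<in> Om \<Longrightarrow> sharp A h (c *\<^sub>R \<beta>) = c *\<^sub>R sharp A h \<beta>"
  by (rule sharp_eqI) (simp_all add: sharp_T T_scaleR h_scaleR h_sharp)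

lemma sharp_smul: "\<beta> \<in> Om \<Longrightarrow> sharp A h (smul f \<beta>) = smul f (sharp A h \<beta>)"
  by (rule sharp_eqI) (simp_all add: sharp_T T_scaleR h_scaleR h_sharp)

section \<open>The induced form and connection\<close>

abbreviation hat where "hat \<equiv> hat_connection A h nabla"

lemma gen_sections_iff: "\<sigma> \<in> gen_sections A \<longleftrightarrow> fst \<circ> \<sigma> \<in> VF \<and> snd \<circ> \<sigma> \<in> Om"
  unfolding gen_sections_def by simp

lemma bilinear_hat: "bilinear_form A (gen_space A) (gen_sections A) (hat_form A h)"
  unfolding bilinear_form_def
proof (intro conjI allI ballI)
  fix p c and x y z assume "x \<in> gen_space A p" "y \<in> gen_space A p" "z \<in> gen_space A p"
  then obtain u \<alpha> v \<beta> w \<gamma> where "x = (u, \<alpha>)" "y = (v, \<beta>)" "z = (w, \<gamma>)"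
    "u \<in> T p" "v \<in> T p" "w \<in> T p"
    "\<alpha> \<in> cotangent_space A p" "\<beta> \<in> cotangent_space A p" "\<gamma> \<in> cotangent_space A p"
    unfolding gen_space_def by blast
  then show "hat_form A h p (x + y) z = hat_form A h p x z + hat_form A h p y z"
    "hat_form A h p z (x + y) = hat_form A h p z x + hat_form A h p z y"
    "hat_form A h p (c *\<^sub>R x) z = c * hat_form A h p x z"
    "hat_form A h p z (c *\<^sub>R x) = c * hat_form A h p z x"
    by (simp_all add: hat_form_eq cov_add cov_scaleR algebra_simps)
next
  fix \<sigma> \<tau> assume *: "\<sigma> \<in> gen_sections A" "\<tau> \<in> gen_sections A"
  then have \<sigma>: "fst \<circ> \<sigma> \<in> VF" "snd \<circ> \<sigma> \<in> Om" and \<tau>: "fst \<circ> \<tau> \<in> VF" "snd \<circ> \<tau> \<in> Om"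
    unfolding gen_sections_iff by blast+
  have "app (hat_form A h) \<sigma> \<tau> =
      (\<lambda>q. - (1 / 2) * ((snd \<circ> \<sigma>) q ((fst \<circ> \<tau>) q) + form_sign * (snd \<circ> \<tau>) q ((fst \<circ> \<sigma>) q)))"
    by (simp add: app_def hat_form_def form_sign_def split_beta)
  also have "\<dots> \<in> R"
    by (rule R_mult[OF R_const[of "- (1 / 2)"]
        R_add[OF Om_D(2)[OF \<sigma>(2) \<tau>(1)] R_mult[OF R_const[of form_sign] Om_D(2)[OF \<tau>(2) \<sigma>(1)]]]])
  finally show "app (hat_form A h) \<sigma> \<tau> \<in> R" .
qed

text \<open>Pairing with (w, 0) forces \<alpha> = 0. Pairing with (0, h(v)) then gives h(u, v) = 0
  for every v, and non-degeneracy of h gives u = 0.\<close>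

lemma nondegenerate_hat: "nondegenerate (gen_space A) (hat_form A h)"
  unfolding nondegenerate_def
proof (intro allI ballI impI)
  fix p x assume x: "x \<in> gen_space A p" and 0: "\<forall>y\<in>gen_space A p. hat_form A h p x y = 0"
  obtain u \<alpha> where x_eq: "x = (u, \<alpha>)" and u: "u \<in> T p" and \<alpha>: "\<alpha> \<in> cotangent_space A p"
    using x unfolding gen_space_def by blast
  have *: "\<alpha> w + form_sign * \<beta> u = 0" if "w \<in> T p" "\<beta> \<in> cotangent_space A p" for w \<beta>
    using bspec[OF 0, of "(w, \<beta>)"] that by (simp add: gen_space_def x_eq hat_form_eq)
  have "0 \<in> cotangent_space A p" unfolding cotangent_space_def by simp
  then have "\<alpha> w = 0" for w
    using *[of w 0] cov_out[OF \<alpha>, of w] by (cases "w \<in> T p") simp_all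
  then have \<alpha>0: "\<alpha> = 0" by (simp add: fun_eq_iff)
  have "u = 0"
  proof (rule h_nondeg[OF u])
    fix v assume v: "v \<in> T p"
    define \<beta> where "\<beta> w = (if w \<in> T p then h p v w else 0)" for w
    have "\<beta> \<in> cotangent_space A p"
      unfolding cotangent_space_def by (simp add: \<beta>_def h_add h_scaleR v T_plus T_scaleR)
    then have "form_sign * h p v u = 0" using *[OF T_zero, of \<beta>] \<alpha>0 u by (simp add: \<beta>_def)
    then show "h p u v = 0" using h_swap[OF u v] by simp
  qed
  then show "x = 0" using \<alpha>0 x_eq by (simp add: zero_prod_def)
qed

lemma hat_apply: "hat \<sigma> \<tau> p = (nabla (fst \<circ> \<sigma>) (fst \<circ> \<tau>) p, flat A h (nabla (fst \<circ> \<sigma>) (sharp A h (snd \<circ> \<tau>))) p)"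
  by (simp add: hat_connection_def)

text \<open>The cotangent part is the given connection conjugated by the module isomorphism h, so it
  inherits every axiom. In the Leibniz rule \<open>flat_sharp\<close> turns the term X(f)
  h(h^-1(\<beta>)) back into X(f) \<beta>.\<close>

lemma affine_connection_hat: "affine_connection A (gen_sections A) fst hat"
  unfolding affine_connection_def
proof (intro conjI ballI allI)
  have fs: "fst \<circ> (\<sigma> + \<tau>) = (fst \<circ> \<sigma>) + (fst \<circ> \<tau>)" "snd \<circ> (\<sigma> + \<tau>) = (snd \<circ> \<sigma>) + (snd \<circ> \<tau>)"
    "fst \<circ> (c *\<^sub>R \<sigma>) = c *\<^sub>R (fst \<circ> \<sigma>)" "snd \<circ> (c *\<^sub>R \<sigma>) = c *\<^sub>R (snd \<circ> \<sigma>)"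
    "fst \<circ> (smul f \<sigma>) = smul f (fst \<circ> \<sigma>)" "snd \<circ> (smul f \<sigma>) = smul f (snd \<circ> \<sigma>)"
    for \<sigma> \<tau> :: "'a \<Rightarrow> 'a tvec \<times> 'a covec" and c f
    by (simp_all add: fun_eq_iff)
  fix \<sigma> \<tau> assume \<sigma>: "\<sigma> \<in> gen_sections A" and \<tau>: "\<tau> \<in> gen_sections A"
  then have X: "fst \<circ> \<sigma> \<in> VF" and Y: "fst \<circ> \<tau> \<in> VF" and \<alpha>: "snd \<circ> \<sigma> \<in> Om" and \<beta>: "snd \<circ> \<tau> \<in> Om"
    unfolding gen_sections_iff by blast+
  note VF = X Y sharp_VF[OF \<alpha>] sharp_VF[OF \<beta>]
  have "fst \<circ> hat \<sigma> \<tau> = nabla (fst \<circ> \<sigma>) (fst \<circ> \<tau>)"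
    "snd \<circ> hat \<sigma> \<tau> = flat A h (nabla (fst \<circ> \<sigma>) (sharp A h (snd \<circ> \<tau>)))"
    by (simp_all add: fun_eq_iff hat_apply)
  then show "hat \<sigma> \<tau> \<in> gen_sections A"
    unfolding gen_sections_iff by (simp add: nabla_VF flat_Om VF)
  {
    fix \<nu> assume \<nu>: "\<nu> \<in> gen_sections A"
    then have Z: "fst \<circ> \<nu> \<in> VF" and \<gamma>: "snd \<circ> \<nu> \<in> Om" unfolding gen_sections_iff by blast+
    show "hat (\<sigma> + \<tau>) \<nu> = hat \<sigma> \<nu> + hat \<tau> \<nu>" "hat \<nu> (\<sigma> + \<tau>) = hat \<nu> \<sigma> + hat \<nu> \<tau>"
      by (simp_all add: fun_eq_iff[of "_ :: 'a \<Rightarrow> 'a tvec \<times> 'a covec"] hat_apply fs nabla_add flat_add sharp_add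
          nabla_VF VF Z sharp_VF[OF \<gamma>] \<alpha> \<beta>)
  }
  show "hat (c *\<^sub>R \<sigma>) \<tau> = c *\<^sub>R hat \<sigma> \<tau>" "hat \<sigma> (c *\<^sub>R \<tau>) = c *\<^sub>R hat \<sigma> \<tau>" for c
    by (simp_all add: fun_eq_iff[of "_ :: 'a \<Rightarrow> 'a tvec \<times> 'a covec"] hat_apply fs nabla_scaleR
        sharp_scaleR flat_scaleR nabla_VF VF \<beta>)
  fix f assume f: "f \<in> R"
  show "hat (smul f \<sigma>) \<tau> = smul f (hat \<sigma> \<tau>)"
    by (simp add: fun_eq_iff[of "_ :: 'a \<Rightarrow> 'a tvec \<times> 'a covec"] hat_apply fs nabla_smul f flat_smul nabla_VF VF)
  have "act id (fst \<circ> \<sigma>) f \<in> R" using VF_D(2)[OF X f] by (simp add: act_def)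
  moreover have "act fst \<sigma> f = act id (fst \<circ> \<sigma>) f" by (simp add: act_def fun_eq_iff)
  ultimately show "hat \<sigma> (smul f \<tau>) = smul (act fst \<sigma> f) \<tau> + smul f (hat \<sigma> \<tau>)"
    by (simp add: fun_eq_iff[of "_ :: 'a \<Rightarrow> 'a tvec \<times> 'a covec"] prod_eq_iff hat_apply fs nabla_smul f flat_smul
        nabla_VF VF sharp_smul \<beta> flat_add VF_smul flat_sharp)
qed

text \<open>The cancellation is term by term: X(\<beta>(Z)), \<beta>(\<nabla>_X Z) and h(\<nabla>_X
  B, Z) each come once from the covariant derivatives and once, with opposite sign, from the
  torsion; likewise with Y, \<alpha> and A. The pairings with C that survive make up the right-hand
  side.\<close>

lemma ext_cov_deriv_hat:
  assumes "\<sigma> \<in> gen_sections A" "\<tau> \<in> gen_sections A" "\<nu> \<in> gen_sections A"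
  shows "ext_cov_deriv fst (gen_bracket A nabla) hat (hat_form A h) \<sigma> \<tau> \<nu> p =
    - (1 / 2) * ext_cov_deriv id lie_bracket nabla h (fst \<circ> \<sigma>) (fst \<circ> \<tau>) (sharp A h (snd \<circ> \<nu>)) p"
proof -
  define X \<alpha> Y \<beta> Z \<gamma> where defs: "X = fst \<circ> \<sigma>" "\<alpha> = snd \<circ> \<sigma>" "Y = fst \<circ> \<tau>" "\<beta> = snd \<circ> \<tau>"
    "Z = fst \<circ> \<nu>" "\<gamma> = snd \<circ> \<nu>"
  have X: "X \<in> VF" and Y: "Y \<in> VF" and Z: "Z \<in> VF" and \<alpha>: "\<alpha> \<in> Om" and \<beta>: "\<beta> \<in> Om" and \<gamma>: "\<gamma> \<in> Om"
    using assms unfolding gen_sections_iff defs by blast+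
  have app: "\<sigma> q = (X q, \<alpha> q)" "\<tau> q = (Y q, \<beta> q)" "\<nu> q = (Z q, \<gamma> q)" for q
    by (simp_all add: defs)
  define A' B C where sharps: "A' = sharp A h \<alpha>" "B = sharp A h \<beta>" "C = sharp A h \<gamma>"
  have A': "A' \<in> VF" and B: "B \<in> VF" and C: "C \<in> VF" unfolding sharps by (intro sharp_VF \<alpha> \<beta> \<gamma>)+
  define tor where "tor = torsion lie_bracket nabla X Y"
  have tor: "tor \<in> VF" unfolding tor_def torsion_def by (intro VF_minus nabla_VF VF_lie_bracket X Y)
  \<comment> \<open>Both symmetry types at once: the sign in the hat form is the one that swaps the
    arguments of h.\<close>
  have \<gamma>C: "form_sign * \<gamma> q w = h q w (C q)" if "w \<in> T q" for q w
    using h_swap[OF that sharp_T[OF \<gamma>]] h_sharp[OF \<gamma> that] by (simp add: sharps)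
  have hat: "hat \<sigma> \<tau> q = (nabla X Y q, flat A h (nabla X B) q)" "hat \<tau> \<sigma> q = (nabla Y X q, flat A h (nabla Y A') q)"
    "hat \<sigma> \<nu> q = (nabla X Z q, flat A h (nabla X C) q)" "hat \<tau> \<nu> q = (nabla Y Z q, flat A h (nabla Y C) q)" for q
    by (simp_all add: hat_apply defs sharps)
  have flat: "flat A h V q (W q) = h q (V q) (W q)" if "W \<in> VF" for V W q
    using VF_D(1)[OF that] by (simp add: flat_def)
  let ?H = "hat_form A h"
  have app_\<tau>\<nu>: "app ?H \<tau> \<nu> = (\<lambda>q. - (1 / 2) * (\<beta> q (Z q) + h q (Y q) (C q)))"
    by (simp add: app_def app hat_form_eq \<gamma>C VF_D(1)[OF Y])
  have app_\<sigma>\<nu>: "app ?H \<sigma> \<nu> = (\<lambda>q. - (1 / 2) * (\<alpha> q (Z q) + h q (X q) (C q)))"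
    by (simp add: app_def app hat_form_eq \<gamma>C VF_D(1)[OF X])
  have act_\<sigma>: "act fst \<sigma> (app ?H \<tau> \<nu>) p = - (1 / 2) * (X p (\<lambda>q. \<beta> q (Z q)) + X p (\<lambda>q. h q (Y q) (C q)))"
    unfolding app_\<tau>\<nu> act_def app fst_conv
    by (simp only: T_scale[OF VF_D(1)[OF X]] T_add[OF VF_D(1)[OF X]] R_add Om_D(2)[OF \<beta> Z] h_smooth Y C)
  have act_\<tau>: "act fst \<tau> (app ?H \<sigma> \<nu>) p = - (1 / 2) * (Y p (\<lambda>q. \<alpha> q (Z q)) + Y p (\<lambda>q. h q (X q) (C q)))"
    unfolding app_\<sigma>\<nu> act_def app fst_conv
    by (simp only: T_scale[OF VF_D(1)[OF Y]] T_add[OF VF_D(1)[OF Y]] R_add Om_D(2)[OF \<alpha> Z] h_smooth X C)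
  have swap: "form_sign * h p (V p) (W p) = h p (W p) (V p)" if "V \<in> VF" "W \<in> VF" for V W
    using h_swap[OF VF_D(1)[OF that(2)] VF_D(1)[OF that(1)]] by simp
  have tor_eq: "torsion (gen_bracket A nabla) hat \<sigma> \<tau> p =
      (tor p, flat A h (nabla X B) p - flat A h (nabla Y A') p - (cov_form A nabla X \<beta> p - cov_form A nabla Y \<alpha> p))"
    by (simp add: torsion_def tor_def hat gen_bracket_def defs(1-4)[symmetric])
  have "app ?H (torsion (gen_bracket A nabla) hat \<sigma> \<tau>) \<nu> p = - (1 / 2) *
      (h p (nabla X B p) (Z p) - h p (nabla Y A' p) (Z p) - (X p (\<lambda>q. \<beta> q (Z q)) - \<beta> p (nabla X Z p))
        + (Y p (\<lambda>q. \<alpha> q (Z q)) - \<alpha> p (nabla Y Z p)) + h p (tor p) (C p))"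
    unfolding app_def tor_eq app hat_form_eq \<gamma>C[OF VF_D(1)[OF tor]]
    by (simp add: flat[OF Z] cov_form(2)[OF X \<beta> Z] cov_form(2)[OF Y \<alpha> Z])
  moreover have "app ?H (hat \<sigma> \<tau>) \<nu> p = - (1 / 2) * (h p (nabla X B p) (Z p) + h p (nabla X Y p) (C p))"
    "app ?H (hat \<tau> \<sigma>) \<nu> p = - (1 / 2) * (h p (nabla Y A' p) (Z p) + h p (nabla Y X p) (C p))"
    by (simp_all add: app_def hat app hat_form_eq flat[OF Z] \<gamma>C VF_D(1)[OF nabla_VF] X Y)
  moreover have "app ?H \<tau> (hat \<sigma> \<nu>) p = - (1 / 2) * (\<beta> p (nabla X Z p) + h p (Y p) (nabla X C p))"
    "app ?H \<sigma> (hat \<tau> \<nu>) p = - (1 / 2) * (\<alpha> p (nabla Y Z p) + h p (X p) (nabla Y C p))"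
    by (simp_all add: app_def hat app hat_form_eq flat[OF X] flat[OF Y] swap nabla_VF X Y C)
  ultimately show ?thesis
    unfolding ext_cov_deriv_def cov_deriv_def
    by (simp add: act_\<sigma> act_\<tau> defs(1,3,6)[symmetric] sharps(3)[symmetric] tor_def[symmetric])
      (simp add: app_def act_def field_simps)
qed

end

theorem theorem3p3:
  fixes A :: "('a::{t2_space,second_countable_topology}, 'e::euclidean_space) atlas"
    and h :: "'a \<Rightarrow> 'a tvec \<Rightarrow> 'a tvec \<Rightarrow> real"
    and nabla :: "('a \<Rightarrow> 'a tvec) \<Rightarrow> ('a \<Rightarrow> 'a tvec) \<Rightarrow> 'a \<Rightarrow> 'a tvec"
  assumes "smooth_atlas A"
    and "bilinear_form A (tangent_space A) (vector_fields A) h"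
    and "nondegenerate (tangent_space A) h"
    and "symmetric_form (tangent_space A) h \<or> skew_form (tangent_space A) h"
    and "affine_connection A (vector_fields A) id nabla"
  shows "gen_quasi_statistical A nabla (hat_form A h) (hat_connection A h nabla)
    \<longleftrightarrow> quasi_statistical A h nabla"
proof -
  interpret form_connection A h nabla by standard (rule assms)+
  let ?d = "ext_cov_deriv id lie_bracket nabla h"
    and ?D = "ext_cov_deriv fst (gen_bracket A nabla) hat (hat_form A h)"
  \<comment> \<open>The remaining clauses of \<open>quasi_stat_structure\<close> hold outright for
    both structures, so only this equivalence has content.\<close>
  have "(\<forall>\<sigma>\<in>gen_sections A. \<forall>\<tau>\<in>gen_sections A. \<forall>\<nu>\<in>gen_sections A. ?D \<sigma> \<tau> \<nu> = 0) \<longleftrightarrow>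
      (\<forall>X\<in>VF. \<forall>Y\<in>VF. \<forall>Z\<in>VF. ?d X Y Z = 0)" (is "?L \<longleftrightarrow> ?R")
  proof
    assume ?R
    show ?L
    proof (intro ballI ext)
      fix \<sigma> \<tau> \<nu> p assume *: "\<sigma> \<in> gen_sections A" "\<tau> \<in> gen_sections A" "\<nu> \<in> gen_sections A"
      then have "?d (fst \<circ> \<sigma>) (fst \<circ> \<tau>) (sharp A h (snd \<circ> \<nu>)) = 0"
        using \<open>?R\<close> unfolding gen_sections_iff by (blast intro: sharp_VF)
      then show "?D \<sigma> \<tau> \<nu> p = 0 p" using ext_cov_deriv_hat[OF *, of p] by simp
    qed
  next
    assume ?L
    show ?R
    proof (intro ballI ext)
      fix X Y Z p assume X: "X \<in> VF" and Y: "Y \<in> VF" and Z: "Z \<in> VF"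
      \<comment> \<open>The covector part h(Z) matters in the third section, where
        \<open>sharp_flat\<close> recovers Z from it. In the first two any 1-form would serve, and
        h(Z) is reused.\<close>
      have sec: "(\<lambda>q. (V q, flat A h Z q)) \<in> gen_sections A" if "V \<in> VF" for V
        using that flat_Om[OF Z] by (simp add: gen_sections_iff o_def)
      have "?D (\<lambda>q. (X q, flat A h Z q)) (\<lambda>q. (Y q, flat A h Z q)) (\<lambda>q. (Z q, flat A h Z q)) p = 0"
        using \<open>?L\<close> sec[OF X] sec[OF Y] sec[OF Z] by simp
      then show "?d X Y Z p = 0 p"
        using ext_cov_deriv_hat[OF sec[OF X] sec[OF Y] sec[OF Z], of p] sharp_flat[OF Z] by (simp add: o_def)
    qed
  qed
  then show ?thesis
    unfolding gen_quasi_statistical_def quasi_statistical_def quasi_stat_structure_def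
    using bilinear nondeg connection bilinear_hat nondegenerate_hat affine_connection_hat by blast
qed

end
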